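(* Let $\Omega$ be an infinite set and let $G$ be an infinite subgroup of $\mathrm{Sym}(\Omega)$ such that every infinite normal subgroup of $G$ is transitive on $\Omega$. Let $\alpha\in\Omega$, let $H:=G_\alpha$ be the stabiliser of $\alpha$ in $G$, and assume that $H$ satisfies the minimal condition on normal subgroups. (1) Suppose that $G$ has a maximal finite normal subgroup $K$. Then $K$ is semi-regular on $\Omega$ (that is, the stabilisers $K_\omega$ are trivial for all $\omega\in\Omega$). Let $\bar G:=G/K$, let $\bar H:=HK/K\cong H$, and let $\bar\Omega:=\Omega/\rho$, where $\rho$ is the $G$-congruence on $\Omega$ whose blocks are the $K$-orbits. Then $\bar G$ acts faithfully on $\bar\Omega$, as a normally infinite group, with stabiliser $\bar H$ (the stabiliser of the $K$-orbit containing $\alpha$). (2) Moreover, suppose that $G$ is normally infinite (equivalently, under the present assumptions, that $G$ is quasiprimitive on $\Omega$). Then either $G$ has a unique minimal normal subgroup $M$, or $G$ has precisely two minimal normal subgroups $M_1, M_2$. (2a) If there is a unique minimal normal subgroup $M$, then either $M$ is abelian and acts regularly on $\Omega$, or $M$ is non-abelian and $C_G(M)=\{1\}$. (2b) If there are two minimal normal subgroups $M_1,M_2$, then each $M_i$ acts regularly on $\Omega$, and the group that they generate is their direct product $M_1\times M_2$. Also, if $M_0:=H\cap(M_1\times M_2)$, then $M_0$ is a minimal normal subgroup of $H$ and $M_0$ projects isomorphically onto each of $M_1$ and $M_2$ (hence $M_1\cong M_2$ and $M_0$ is the diagonal of the direct product).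
   Context: A group satisfies the minimal condition on normal subgroups (min-N) if every non-empty set of its normal subgroups has a minimal member with respect to inclusion. A group $X$ is called normally infinite if all its non-trivial normal subgroups are infinite (equivalently, $\{1\}$ is the maximal finite normal subgroup of $X$). A "maximal finite normal subgroup" of $X$ is a finite normal subgroup not properly contained in another finite normal subgroup; since the product of two finite normal subgroups is finite and normal, it is then the unique largest finite normal subgroup. A minimal normal subgroup means a minimal member of the set of non-trivial normal subgroups. A permutation group is quasiprimitive if all its non-trivial normal subgroups are transitive. A permutation group acts regularly if it is transitive with trivial point stabilisers. A $G$-congruence is a $G$-invariant equivalence relation on $\Omega$. *)

theory Defs
  imports "HOL-Algebra.Group_Action" "HOL-Algebra.Generated_Groups"
begin

text \<open>
  \<open>Sym(\<Omega>)\<close> is \<^term>\<open>BijGroup \<Omega>\<close>; it acts on the left (its product is composition) and its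
  elements are extensional functions, so its identity is \<open>\<lambda>x\<in>\<Omega>. x\<close>. A permutation group on \<open>\<Omega>\<close>
  acts through the map \<open>\<lambda>g. g\<close>.
\<close>

abbreviation perm_group :: "'a set \<Rightarrow> ('a \<Rightarrow> 'a) set \<Rightarrow> ('a \<Rightarrow> 'a) monoid" where
  "perm_group \<Omega> G \<equiv> BijGroup \<Omega>\<lparr>carrier := G\<rparr>"

definition transitive_on :: "'a set \<Rightarrow> ('a \<Rightarrow> 'a) set \<Rightarrow> bool" where
  "transitive_on \<Omega> G \<longleftrightarrow> transitive_action (perm_group \<Omega> G) \<Omega> (\<lambda>g. g)"

definition point_stabilizer :: "'a set \<Rightarrow> ('a \<Rightarrow> 'a) set \<Rightarrow> 'a \<Rightarrow> ('a \<Rightarrow> 'a) set" where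
  "point_stabilizer \<Omega> G x = stabilizer (perm_group \<Omega> G) (\<lambda>g. g) x"

definition semiregular_on :: "'a set \<Rightarrow> ('a \<Rightarrow> 'a) set \<Rightarrow> bool" where
  "semiregular_on \<Omega> G \<longleftrightarrow> (\<forall>x\<in>\<Omega>. point_stabilizer \<Omega> G x = {\<one>\<^bsub>BijGroup \<Omega>\<^esub>})"

definition regular_on :: "'a set \<Rightarrow> ('a \<Rightarrow> 'a) set \<Rightarrow> bool" where
  "regular_on \<Omega> G \<longleftrightarrow> transitive_on \<Omega> G \<and> semiregular_on \<Omega> G"

definition quasiprimitive_on :: "'a set \<Rightarrow> ('a \<Rightarrow> 'a) set \<Rightarrow> bool" where
  "quasiprimitive_on \<Omega> G \<longleftrightarrow>
    (\<forall>N. N \<lhd> perm_group \<Omega> G \<and> N \<noteq> {\<one>\<^bsub>BijGroup \<Omega>\<^esub>} \<longrightarrow> transitive_on \<Omega> N)"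

definition min_N :: "('g, 'b) monoid_scheme \<Rightarrow> bool" where
  "min_N X \<longleftrightarrow>
    (\<forall>S. S \<noteq> {} \<and> S \<subseteq> {N. N \<lhd> X} \<longrightarrow> (\<exists>M\<in>S. \<forall>N\<in>S. N \<subseteq> M \<longrightarrow> N = M))"

definition normally_infinite :: "('g, 'b) monoid_scheme \<Rightarrow> bool" where
  "normally_infinite X \<longleftrightarrow> (\<forall>N. N \<lhd> X \<and> N \<noteq> {\<one>\<^bsub>X\<^esub>} \<longrightarrow> infinite N)"

definition maximal_finite_normal :: "'g set \<Rightarrow> ('g, 'b) monoid_scheme \<Rightarrow> bool" where
  "maximal_finite_normal K X \<longleftrightarrow>
    K \<lhd> X \<and> finite K \<and> (\<forall>L. L \<lhd> X \<and> finite L \<and> K \<subseteq> L \<longrightarrow> L = K)"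

definition minimal_normal :: "'g set \<Rightarrow> ('g, 'b) monoid_scheme \<Rightarrow> bool" where
  "minimal_normal M X \<longleftrightarrow>
    M \<lhd> X \<and> M \<noteq> {\<one>\<^bsub>X\<^esub>} \<and> (\<forall>N. N \<lhd> X \<and> N \<noteq> {\<one>\<^bsub>X\<^esub>} \<and> N \<subseteq> M \<longrightarrow> N = M)"

definition centralizer :: "('g, 'b) monoid_scheme \<Rightarrow> 'g set \<Rightarrow> 'g set" where
  "centralizer X S = {g \<in> carrier X. \<forall>s\<in>S. g \<otimes>\<^bsub>X\<^esub> s = s \<otimes>\<^bsub>X\<^esub> g}"

definition congruence_on :: "'a set \<Rightarrow> ('a \<Rightarrow> 'a) set \<Rightarrow> ('a \<times> 'a) set \<Rightarrow> bool" where
  "congruence_on \<Omega> G \<rho> \<longleftrightarrow> equiv \<Omega> \<rho> \<and> (\<forall>g\<in>G. \<forall>(x, y)\<in>\<rho>. (g x, g y) \<in> \<rho>)"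

definition orbit_rel :: "'a set \<Rightarrow> ('a \<Rightarrow> 'a) set \<Rightarrow> ('a \<times> 'a) set" where
  "orbit_rel \<Omega> K = {(x, y). x \<in> \<Omega> \<and> y \<in> orbit (perm_group \<Omega> K) (\<lambda>g. g) x}"

text \<open>
  A coset \<open>Kg\<close> sends a block \<open>B\<close> to \<open>{c x | c \<in> Kg, x \<in> B}\<close>. When the blocks are the \<open>K\<close>-orbits and
  \<open>K\<close> is normal, this is just the block \<open>g ` B\<close>.
\<close>

definition block_action :: "'a set set \<Rightarrow> ('a \<Rightarrow> 'a) set \<Rightarrow> 'a set \<Rightarrow> 'a set" where
  "block_action \<B> C = (\<lambda>B\<in>\<B>. \<Union>c\<in>C. c ` B)"

text \<open>
  Internal direct products: \<open>M\<^sub>1 \<times> M\<^sub>2\<close> is identified with a subgroup of \<open>X\<close> along the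
  multiplication map, and the projections are taken along its inverse.
\<close>

definition mult_map :: "('g, 'b) monoid_scheme \<Rightarrow> 'g \<times> 'g \<Rightarrow> 'g" where
  "mult_map X = (\<lambda>(a, b). a \<otimes>\<^bsub>X\<^esub> b)"

definition proj_fst :: "('g, 'b) monoid_scheme \<Rightarrow> 'g set \<Rightarrow> 'g set \<Rightarrow> 'g \<Rightarrow> 'g" where
  "proj_fst X M\<^sub>1 M\<^sub>2 g = fst (the_inv_into (M\<^sub>1 \<times> M\<^sub>2) (mult_map X) g)"

definition proj_snd :: "('g, 'b) monoid_scheme \<Rightarrow> 'g set \<Rightarrow> 'g set \<Rightarrow> 'g \<Rightarrow> 'g" where
  "proj_snd X M\<^sub>1 M\<^sub>2 g = snd (the_inv_into (M\<^sub>1 \<times> M\<^sub>2) (mult_map X) g)"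

end

theory Submission
  imports Defs
begin

text \<open>
  A finite normal subgroup \<open>K\<close> has a centralizer of finite index, which is infinite and hence
  transitive; the centralizer of a transitive group is semiregular, so \<open>K\<close> is. An element fixing
  all \<open>K\<close>-orbits lies in the kernel \<open>L\<close> of the action on orbits; \<open>L\<close> is not transitive, as the
  \<open>K\<close>-orbits are finite, so \<open>L\<close> is finite and \<open>L = K\<close> by maximality.

  If all non-trivial normal subgroups are transitive, then \<open>G = N H\<close> for each of them, so a normal
  subgroup \<open>N\<close> with \<open>N \<inter> H\<close> minimal is itself minimal. Two distinct minimal normal subgroups
  centralize each other, so each is the full, regular, centralizer of the other, which leaves no
  room for a third. The element \<open>x y\<close> of \<open>M\<^sub>1 \<times> M\<^sub>2\<close> fixes \<open>\<alpha>\<close> for exactly one \<open>y\<close> given \<open>x\<close>, and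
  conversely, so \<open>M\<^sub>0\<close> is the graph of an isomorphism.
\<close>

section \<open>Centralizers and minimal normal subgroups\<close>

context group
begin

lemma inv_mult_cancel:
  assumes "x \<in> carrier G" "y \<in> carrier G"
  shows "inv x \<otimes> (x \<otimes> y) = y" "x \<otimes> (inv x \<otimes> y) = y"
  using assms by (simp_all flip: m_assoc)

text \<open>Both sides of the first equation are conjugates by \<open>x\<close> of the sides of the
  second, and conjugation is injective. This moves a conjugation from the centralizing element to
  the centralized one, which is how \<open>centralizer G N\<close> inherits normality from
  \<open>N\<close>.\<close>

lemma conj_mult_eq_mult_conj_iff:
  assumes "x \<in> carrier G" "g \<in> carrier G" "s \<in> carrier G"
  shows "x \<otimes> g \<otimes> inv x \<otimes> s = s \<otimes> (x \<otimes> g \<otimes> inv x) \<longleftrightarrow>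
    g \<otimes> (inv x \<otimes> s \<otimes> x) = (inv x \<otimes> s \<otimes> x) \<otimes> g"
proof -
  have "x \<otimes> g \<otimes> inv x \<otimes> s = x \<otimes> (g \<otimes> (inv x \<otimes> s \<otimes> x)) \<otimes> inv x"
    "s \<otimes> (x \<otimes> g \<otimes> inv x) = x \<otimes> ((inv x \<otimes> s \<otimes> x) \<otimes> g) \<otimes> inv x"
    using assms by (simp_all add: m_assoc inv_mult_cancel)
  then show ?thesis
    using assms by (metis conjugation_is_inj inv_closed m_closed)
qed

lemma centralizer_subgroup:
  assumes "S \<subseteq> carrier G"
  shows "subgroup (centralizer G S) G"
proof (rule subgroupI)
  show "centralizer G S \<noteq> {}"
    using assms by (force simp: centralizer_def)
  show "inv a \<in> centralizer G S" if "a \<in> centralizer G S" for a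
    using that assms unfolding centralizer_def
    by (auto intro!: inv_solve_left[THEN iffD2, symmetric] simp: subset_iff)
       (metis inv_closed inv_solve_left' inv_solve_right' m_assoc m_closed)
  show "a \<otimes> b \<in> centralizer G S" if "a \<in> centralizer G S" "b \<in> centralizer G S" for a b
    using that assms unfolding centralizer_def
    by (auto simp: subset_iff) (metis m_assoc)
qed (auto simp: centralizer_def)

text \<open>Commutativity becomes an inclusion, the form in which it can be played off against a
  trivial or a semiregular centralizer.\<close>

lemma comm_group_iff_subset_centralizer:
  assumes "subgroup M G"
  shows "comm_group (G\<lparr>carrier := M\<rparr>) \<longleftrightarrow> M \<subseteq> centralizer G M"
proof
  assume "comm_group (G\<lparr>carrier := M\<rparr>)"
  then interpret M: comm_group "G\<lparr>carrier := M\<rparr>" .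
  show "M \<subseteq> centralizer G M"
    using M.m_comm subgroup.mem_carrier[OF assms] by (auto simp: centralizer_def)
next
  assume "M \<subseteq> centralizer G M"
  then show "comm_group (G\<lparr>carrier := M\<rparr>)"
    using group.group_comm_groupI[OF subgroup_imp_group[OF assms]] by (auto simp: centralizer_def)
qed

lemma centralizer_normal:
  assumes "N \<lhd> G"
  shows "centralizer G N \<lhd> G"
proof (rule normal_invI)
  interpret N: normal N G by fact
  show "subgroup (centralizer G N) G"
    by (rule centralizer_subgroup[OF N.subset])
  fix x g assume x: "x \<in> carrier G" and g: "g \<in> centralizer G N"
  have "g \<otimes> (inv x \<otimes> s \<otimes> x) = (inv x \<otimes> s \<otimes> x) \<otimes> g" if "s \<in> N" for s
    using g N.inv_op_closed1[OF x that] by (auto simp: centralizer_def)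
  then show "x \<otimes> g \<otimes> inv x \<in> centralizer G N"
    using x g conj_mult_eq_mult_conj_iff by (auto simp: centralizer_def)
qed

text \<open>The commutator of \<open>x\<close> and \<open>y\<close> lies in both subgroups:
  bracketed one way it is a conjugate of \<open>y\<close> times \<open>inv y\<close>, bracketed the
  other way it is \<open>x\<close> times a conjugate of \<open>inv x\<close>.\<close>

lemma normal_subgroups_commute:
  assumes "M \<lhd> G" "N \<lhd> G" "M \<inter> N = {\<one>}" "x \<in> M" "y \<in> N"
  shows "x \<otimes> y = y \<otimes> x"
proof -
  interpret M: normal M G by fact
  interpret N: normal N G by fact
  have xy: "x \<in> carrier G" "y \<in> carrier G"
    using assms by auto
  have "(x \<otimes> y \<otimes> inv x) \<otimes> inv y \<in> N"
    using N.inv_op_closed2[of x y] assms xy by blast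
  moreover have "x \<otimes> (y \<otimes> inv x \<otimes> inv y) \<in> M"
    using M.inv_op_closed2[of y "inv x"] assms xy by blast
  moreover have "x \<otimes> (y \<otimes> inv x \<otimes> inv y) = (x \<otimes> y \<otimes> inv x) \<otimes> inv y"
    using xy by (simp add: m_assoc)
  ultimately have "x \<otimes> y \<otimes> inv x \<otimes> inv y = \<one>"
    using assms(3) by auto
  then show ?thesis
    using xy by (metis inv_closed inv_solve_right' l_one m_closed one_closed)
qed

text \<open>The intersection is normal; were it non-trivial, minimality would make it equal to both
  \<open>M\<close> and \<open>N\<close>.\<close>

lemma minimal_normal_Int:
  assumes "minimal_normal M G" "minimal_normal N G" "M \<noteq> N"
  shows "M \<inter> N = {\<one>}"
  using assms normal_subgroup_intersect[of M N] unfolding minimal_normal_def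
  by (metis inf_le1 inf_le2)

section \<open>Internal direct products and their projections\<close>

lemma mult_mult_swap:
  assumes "a \<in> carrier G" "b \<in> carrier G" "c \<in> carrier G" "d \<in> carrier G" "b \<otimes> c = c \<otimes> b"
  shows "(a \<otimes> b) \<otimes> (c \<otimes> d) = (a \<otimes> c) \<otimes> (b \<otimes> d)"
proof -
  have "(a \<otimes> b) \<otimes> (c \<otimes> d) = a \<otimes> (b \<otimes> c) \<otimes> d"
    using assms(1-4) by (simp add: m_assoc)
  also have "\<dots> = (a \<otimes> c) \<otimes> (b \<otimes> d)"
    using assms by (simp add: m_assoc)
  finally show ?thesis .
qed

text \<open>Commutation makes multiplication a homomorphism and its image a subgroup; the trivial
  intersection makes the factorization of an element unique.\<close>

lemma mult_map_iso:
  assumes M: "subgroup M G" and N: "subgroup N G" and "M \<inter> N = {\<one>}"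
    and comm: "\<And>x y. x \<in> M \<Longrightarrow> y \<in> N \<Longrightarrow> x \<otimes> y = y \<otimes> x"
  shows "mult_map G \<in> iso (G\<lparr>carrier := M\<rparr> \<times>\<times> G\<lparr>carrier := N\<rparr>) (subgroup_generated G (M \<union> N))"
    and "generate G (M \<union> N) = {x \<otimes> y | x y. x \<in> M \<and> y \<in> N}"
proof -
  interpret M: subgroup M G by fact
  interpret N: subgroup N G by fact
  have mult: "x \<otimes> x' \<otimes> (y \<otimes> y') = x \<otimes> y \<otimes> (x' \<otimes> y')"
    if "x \<in> M" "x' \<in> M" "y \<in> N" "y' \<in> N" for x x' y y'
    using that by (intro mult_mult_swap) (auto intro: comm)
  \<comment> \<open>Sorting two equal products by factors yields a single element written once in
    \<open>M\<close> and once in \<open>N\<close>, hence \<open>\<one>\<close>.\<close>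
  have inj: "x = x' \<and> y = y'"
    if "x \<in> M" "x' \<in> M" "y \<in> N" "y' \<in> N" "x \<otimes> y = x' \<otimes> y'" for x x' y y'
  proof -
    have "inv x' \<otimes> x = y' \<otimes> inv y"
      using that by (metis M.m_inv_closed M.mem_carrier N.m_inv_closed N.mem_carrier inv_solve_left
          inv_solve_right m_assoc m_closed)
    moreover have "inv x' \<otimes> x \<in> M" "y' \<otimes> inv y \<in> N"
      using that by auto
    ultimately have "inv x' \<otimes> x = \<one>" "y' \<otimes> inv y = \<one>"
      using \<open>M \<inter> N = {\<one>}\<close> by auto
    then show ?thesis
      using that by (metis M.mem_carrier N.mem_carrier inv_closed inv_equality inv_inv)
  qed
  let ?P = "{x \<otimes> y | x y. x \<in> M \<and> y \<in> N}"
  have "subgroup ?P G"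
  proof (rule subgroupI)
    show "inv a \<in> ?P" if a: "a \<in> ?P" for a
    proof -
      obtain x y where "x \<in> M" "y \<in> N" "a = x \<otimes> y"
        using a by auto
      then have "inv a = inv x \<otimes> inv y"
        using comm[of "inv x" "inv y"] by (simp add: inv_mult_group)
      then show ?thesis
        using \<open>x \<in> M\<close> \<open>y \<in> N\<close> by blast
    qed
    show "a \<otimes> b \<in> ?P" if ab: "a \<in> ?P" "b \<in> ?P" for a b
    proof -
      obtain x y x' y' where "x \<in> M" "y \<in> N" "a = x \<otimes> y" "x' \<in> M" "y' \<in> N" "b = x' \<otimes> y'"
        using ab by auto
      then have "a \<otimes> b = (x \<otimes> x') \<otimes> (y \<otimes> y')"
        by (simp flip: mult)
      then show ?thesis
        using \<open>x \<in> M\<close> \<open>y \<in> N\<close> \<open>x' \<in> M\<close> \<open>y' \<in> N\<close> by blast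
    qed
    show "?P \<noteq> {}"
      using M.one_closed N.one_closed by blast
  qed auto
  moreover have "M \<union> N \<subseteq> ?P"
  proof
    fix z assume "z \<in> M \<union> N"
    then have "z \<in> M \<and> z = z \<otimes> \<one> \<or> z \<in> N \<and> z = \<one> \<otimes> z"
      by auto
    then show "z \<in> ?P"
      using M.one_closed N.one_closed by blast
  qed
  ultimately show gen: "generate G (M \<union> N) = ?P"
  proof (rule generateI[symmetric])
    fix K assume K: "subgroup K G" "M \<union> N \<subseteq> K"
    then have "x \<otimes> y \<in> K" if "x \<in> M" "y \<in> N" for x y
      using that by (intro subgroup.m_closed) auto
    then show "?P \<subseteq> K"
      by auto
  qed
  have "carrier (subgroup_generated G (M \<union> N)) = ?P"
    using M.subset N.subset by (simp add: carrier_subgroup_generated gen inf.absorb2)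
  then show "mult_map G \<in> iso (G\<lparr>carrier := M\<rparr> \<times>\<times> G\<lparr>carrier := N\<rparr>) (subgroup_generated G (M \<union> N))"
    using inj by (intro isoI homI bij_betw_imageI inj_onI) (auto simp: mult_map_def mult)
qed

text \<open>The projections are defined through \<open>the_inv_into\<close>, which can be evaluated
  only once the multiplication map is known to be injective.\<close>

lemma proj_mult:
  assumes "subgroup M G" "subgroup N G" "M \<inter> N = {\<one>}"
    and "\<And>x y. x \<in> M \<Longrightarrow> y \<in> N \<Longrightarrow> x \<otimes> y = y \<otimes> x"
    and "x \<in> M" "y \<in> N"
  shows "proj_fst G M N (x \<otimes> y) = x" "proj_snd G M N (x \<otimes> y) = y"
proof -
  have "inj_on (mult_map G) (M \<times> N)"
    using mult_map_iso(1)[OF assms(1-4)] by (simp add: iso_def bij_betw_def)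
  then have "the_inv_into (M \<times> N) (mult_map G) (mult_map G (x, y)) = (x, y)"
    using assms by (intro the_inv_into_f_f) auto
  then show "proj_fst G M N (x \<otimes> y) = x" "proj_snd G M N (x \<otimes> y) = y"
    by (simp_all add: proj_fst_def proj_snd_def mult_map_def)
qed

text \<open>Operations and inverses in the restricted monoid are those of \<open>G\<close>, so
  normality in a subgroup, such as a point stabilizer, can be unpacked into conditions in
  \<open>G\<close>.\<close>

lemma normal_in_subgroup_iff:
  assumes "subgroup H G"
  shows "N \<lhd> G\<lparr>carrier := H\<rparr> \<longleftrightarrow>
    subgroup N G \<and> N \<subseteq> H \<and> (\<forall>x\<in>H. \<forall>n\<in>N. x \<otimes> n \<otimes> inv x \<in> N)"
proof -
  have "subgroup N (G\<lparr>carrier := H\<rparr>) \<longleftrightarrow> subgroup N G \<and> N \<subseteq> H"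
    using incl_subgroup[OF assms] subgroup_incl[OF _ assms] subgroup.subset[of N "G\<lparr>carrier := H\<rparr>"]
    by auto
  then show ?thesis
    using group.normal_inv_iff[OF subgroup_imp_group[OF assms]] assms by auto
qed

end

section \<open>Quasiprimitive actions\<close>

sublocale group_action \<subseteq> group G
  using group_hom group_hom.axioms(1) by auto

context group_action
begin

text \<open>This notion and the next are elementwise: they speak of arbitrary sets of group elements
  and leave the carrier of the acting group unchanged, so that subgroups of \<open>G\<close> can be
  compared within one action.\<close>

definition acts_transitively :: "'a set \<Rightarrow> bool" where
  "acts_transitively N \<longleftrightarrow> (\<forall>x\<in>E. \<forall>y\<in>E. \<exists>g\<in>N. \<phi> g x = y)"

definition acts_semiregularly :: "'a set \<Rightarrow> bool" where
  "acts_semiregularly N \<longleftrightarrow> (\<forall>x\<in>E. \<forall>g\<in>N. \<phi> g x = x \<longrightarrow> g = \<one>)"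

lemma semiregular_inj:
  assumes "acts_semiregularly C" "subgroup C G" "g \<in> C" "h \<in> C" "x \<in> E" "\<phi> g x = \<phi> h x"
  shows "g = h"
proof -
  interpret C: subgroup C G by fact
  have "\<phi> (inv h \<otimes> g) x = x"
    using assms by (simp add: composition_rule orbit_sym_aux)
  then have "inv h \<otimes> g = \<one>"
    using assms unfolding acts_semiregularly_def by blast
  then show ?thesis
    using assms by (metis C.mem_carrier inv_closed inv_equality inv_inv)
qed

text \<open>At a chosen point each \<open>c\<close> in \<open>C\<close> agrees with some
  \<open>n\<close> in \<open>N\<close>. Both lie in the semiregular \<open>C\<close>, so they
  coincide.\<close>

lemma transitive_eq_semiregular:
  assumes "acts_transitively N" "N \<subseteq> C" "acts_semiregularly C" "subgroup C G" "E \<noteq> {}"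
  shows "N = C"
proof (intro equalityI subsetI)
  fix c assume c: "c \<in> C"
  obtain x where x: "x \<in> E"
    using assms by blast
  then have "\<phi> c x \<in> E"
    using assms c element_image subgroup.mem_carrier by metis
  then obtain n where "n \<in> N" "\<phi> n x = \<phi> c x"
    using assms x unfolding acts_transitively_def by blast
  then show "c \<in> N"
    using semiregular_inj assms c x by blast
qed (use assms in auto)

text \<open>The Frattini argument: take \<open>n\<close> in \<open>N\<close> with the same value as
  \<open>g\<close> at \<open>x\<close>; then \<open>inv n \<otimes> g\<close> fixes
  \<open>x\<close>.\<close>

lemma transitive_factorization:
  assumes "acts_transitively N" "subgroup N G" "x \<in> E" "g \<in> carrier G"
  obtains n h where "n \<in> N" "h \<in> stabilizer G \<phi> x" "g = n \<otimes> h"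
proof -
  interpret N: subgroup N G by fact
  obtain n where n: "n \<in> N" "\<phi> n x = \<phi> g x"
    using assms element_image unfolding acts_transitively_def by metis
  then have "\<phi> (inv n \<otimes> g) x = x"
    using assms by (simp add: composition_rule orbit_sym_aux)
  then have "inv n \<otimes> g \<in> stabilizer G \<phi> x"
    using assms n by (simp add: stabilizer_def)
  moreover have "g = n \<otimes> (inv n \<otimes> g)"
    using assms n by (simp flip: m_assoc)
  ultimately show ?thesis
    using n that by blast
qed

end

context faithful_action
begin

text \<open>Members of \<open>Bij E\<close> are extensional, so agreement with the identity on
  \<open>E\<close> already gives equality of functions, and faithfulness lifts it to the
  group.\<close>

lemma fixes_all_imp_one:
  assumes "g \<in> carrier G" "\<And>x. x \<in> E \<Longrightarrow> \<phi> g x = x"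
  shows "g = \<one>"
proof -
  have "\<phi> g = \<phi> \<one>"
    using assms bij_prop0[of g] Bij_imp_extensional
    by (fastforce simp flip: id_eq_one intro: extensionalityI[of _ E])
  then show ?thesis
    using faithful assms by (simp add: inj_on_eq_iff)
qed

text \<open>If \<open>g\<close> commutes with \<open>N\<close> and fixes \<open>x\<close>, then it
  fixes every \<open>\<phi> n x\<close> as well, and by transitivity these are all the
  points.\<close>

lemma centralizer_semiregular:
  assumes "acts_transitively N" "N \<subseteq> carrier G"
  shows "acts_semiregularly (centralizer G N)"
  unfolding acts_semiregularly_def
proof (intro ballI impI)
  fix x g assume x: "x \<in> E" and g: "g \<in> centralizer G N" and gx: "\<phi> g x = x"
  have "g \<in> carrier G"
    using g by (simp add: centralizer_def)
  moreover have "\<phi> g y = y" if "y \<in> E" for y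
  proof -
    obtain n where n: "n \<in> N" "\<phi> n x = y"
      using assms x \<open>y \<in> E\<close> unfolding acts_transitively_def by blast
    then have "\<phi> g y = \<phi> (g \<otimes> n) x"
      using assms x \<open>g \<in> carrier G\<close> by (auto simp: composition_rule)
    also have "g \<otimes> n = n \<otimes> g"
      using g n by (simp add: centralizer_def)
    also have "\<phi> (n \<otimes> g) x = y"
      using assms x n \<open>g \<in> carrier G\<close> gx by (auto simp: composition_rule)
    finally show ?thesis .
  qed
  ultimately show "g = \<one>"
    by (rule fixes_all_imp_one)
qed

end

text \<open>The base point makes \<open>E\<close> non-empty, and its stabilizer is the group on
  which the minimal condition will be imposed.\<close>

locale quasiprimitive_action = faithful_action +
  fixes \<alpha>
  assumes point: "\<alpha> \<in> E"
    and normal_transitive: "N \<lhd> G \<Longrightarrow> N \<noteq> {\<one>} \<Longrightarrow> acts_transitively N"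
begin

lemma minimal_normal_transitive: "minimal_normal M G \<Longrightarrow> acts_transitively M"
  using normal_transitive by (simp add: minimal_normal_def)

text \<open>The minimal condition holds in the stabilizer, so it is applied there to the traces
  \<open>N \<inter> ?H\<close> of the non-trivial normal subgroups \<open>N\<close> of
  \<open>G\<close> inside \<open>L\<close>. The bound \<open>L\<close> is later the whole group, for
  existence, and then the centralizer of a minimal normal subgroup.\<close>

lemma exists_minimal_normal:
  assumes "min_N (G\<lparr>carrier := stabilizer G \<phi> \<alpha>\<rparr>)" "L \<lhd> G" "L \<noteq> {\<one>}"
  obtains M where "minimal_normal M G" "M \<subseteq> L"
proof -
  let ?H = "stabilizer G \<phi> \<alpha>"
  let ?F = "{N. N \<lhd> G \<and> N \<noteq> {\<one>} \<and> N \<subseteq> L}"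
  let ?S = "(\<lambda>N. N \<inter> ?H) ` ?F"
  have "?S \<subseteq> {N. N \<lhd> G\<lparr>carrier := ?H\<rparr>}" "?S \<noteq> {}"
    using assms normal_Int_subgroup stabilizer_subgroup[OF point] by auto
  then have "\<exists>D\<in>?S. \<forall>N\<in>?S. N \<subseteq> D \<longrightarrow> N = D"
    by (rule assms(1)[unfolded min_N_def, THEN spec, THEN mp, OF conjI[rotated]])
  then obtain D where D: "D \<in> ?S" and min: "\<forall>N\<in>?S. N \<subseteq> D \<longrightarrow> N = D"
    by (elim bexE)
  from D obtain M where M: "M \<in> ?F" "D = M \<inter> ?H"
    by blast
  have "M \<subseteq> N" if N: "N \<lhd> G" "N \<noteq> {\<one>}" "N \<subseteq> M" for N
  proof
    \<comment> \<open>\<open>N\<close> is transitive and \<open>N \<inter> H = M \<inter> H\<close>, so \<open>M = N (M \<inter> H) = N\<close>.\<close>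
    fix g assume g: "g \<in> M"
    interpret N: normal N G by fact
    interpret M: normal M G using M by blast
    obtain n h where nh: "n \<in> N" "h \<in> ?H" "g = n \<otimes> h"
      using transitive_factorization[OF normal_transitive[OF N(1,2)] N.subgroup_axioms point
          M.mem_carrier[OF g]] .
    have "h \<in> carrier G"
      using nh by (simp add: stabilizer_def)
    then have "inv n \<otimes> g = h"
      using nh by (simp flip: m_assoc)
    then have "h \<in> M \<inter> ?H"
      using nh(1,2) g N M.m_closed[of "inv n" g] by auto
    moreover have "N \<inter> ?H \<in> ?S"
      using M N by (intro imageI) auto
    moreover have "N \<inter> ?H \<subseteq> D"
      unfolding \<open>D = M \<inter> ?H\<close> using \<open>N \<subseteq> M\<close> by (rule Int_mono) simp
    ultimately have "h \<in> N \<inter> ?H"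
      using min[THEN bspec, THEN mp, of "N \<inter> ?H"] \<open>D = M \<inter> ?H\<close> by simp
    then show "g \<in> N"
      using nh by simp
  qed
  then have "minimal_normal M G"
    using M unfolding minimal_normal_def by blast
  then show ?thesis
    using that M by blast
qed

section \<open>Two distinct minimal normal subgroups as mutual centralizers\<close>

context
  fixes M\<^sub>1 M\<^sub>2
  assumes min: "minimal_normal M\<^sub>1 G" "minimal_normal M\<^sub>2 G" and distinct: "M\<^sub>1 \<noteq> M\<^sub>2"
begin

interpretation M1: normal M\<^sub>1 G
  using min by (simp add: minimal_normal_def)

interpretation M2: normal M\<^sub>2 G
  using min by (simp add: minimal_normal_def)

lemma distinct_minimal_normal_commute: "x \<in> M\<^sub>1 \<Longrightarrow> y \<in> M\<^sub>2 \<Longrightarrow> x \<otimes> y = y \<otimes> x"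
  using normal_subgroups_commute minimal_normal_Int[OF min distinct]
    M1.normal_axioms M2.normal_axioms by blast

text \<open>\<open>M\<^sub>2\<close> is a transitive subgroup of the semiregular centralizer of
  \<open>M\<^sub>1\<close>, so it exhausts it. As the right-hand side depends on
  \<open>M\<^sub>1\<close> alone, a third minimal normal subgroup is excluded.\<close>

lemma distinct_minimal_normal_eq_centralizer: "M\<^sub>2 = centralizer G M\<^sub>1"
proof (rule transitive_eq_semiregular)
  show "M\<^sub>2 \<subseteq> centralizer G M\<^sub>1"
    using distinct_minimal_normal_commute by (auto simp: centralizer_def)
  show "acts_semiregularly (centralizer G M\<^sub>1)"
    using centralizer_semiregular minimal_normal_transitive min M1.subset by blast
qed (use min minimal_normal_transitive point centralizer_subgroup M1.subset in auto)

text \<open>One of the two subgroups suffices, since the hypotheses on the pair are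
  symmetric.\<close>

lemma distinct_minimal_normal_semiregular: "acts_semiregularly M\<^sub>2"
  using centralizer_semiregular minimal_normal_transitive min M1.subset
    distinct_minimal_normal_eq_centralizer by metis

end

lemma minimal_normal_cases:
  assumes "min_N (G\<lparr>carrier := stabilizer G \<phi> \<alpha>\<rparr>)" "carrier G \<noteq> {\<one>}"
  shows "(\<exists>M. {N. minimal_normal N G} = {M}) \<or>
    (\<exists>M\<^sub>1 M\<^sub>2. M\<^sub>1 \<noteq> M\<^sub>2 \<and> {N. minimal_normal N G} = {M\<^sub>1, M\<^sub>2})"
proof -
  obtain M where M: "minimal_normal M G"
    using exists_minimal_normal[OF assms(1) normal_self assms(2)] .
  show ?thesis
  proof (cases "\<exists>N. minimal_normal N G \<and> N \<noteq> M")
    case True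
    then obtain N where "minimal_normal N G" "N \<noteq> M"
      by blast
    \<comment> \<open>Any minimal normal subgroup other than \<open>M\<close> is the centralizer of
      \<open>M\<close>, and so is \<open>N\<close>.\<close>
    then have "{N. minimal_normal N G} = {M, N}"
      using M distinct_minimal_normal_eq_centralizer by blast
    then show ?thesis
      using \<open>N \<noteq> M\<close> by blast
  next
    case False
    then have "{N. minimal_normal N G} = {M}"
      using M by blast
    then show ?thesis
      by blast
  qed
qed

text \<open>A non-trivial centralizer of \<open>M\<close> is normal and thus contains a minimal
  normal subgroup, which can only be \<open>M\<close>; then \<open>M\<close> is abelian, and
  semiregular as a subset of its semiregular centralizer. If the centralizer is trivial, an abelian
  \<open>M\<close> would be contained in it and be trivial too.\<close>

lemma unique_minimal_normal:
  assumes "min_N (G\<lparr>carrier := stabilizer G \<phi> \<alpha>\<rparr>)" and uniq: "{N. minimal_normal N G} = {M}"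
  shows "comm_group (G\<lparr>carrier := M\<rparr>) \<and> acts_transitively M \<and> acts_semiregularly M \<or>
    \<not> comm_group (G\<lparr>carrier := M\<rparr>) \<and> centralizer G M = {\<one>}"
proof -
  have M: "minimal_normal M G"
    using uniq by blast
  then interpret M: normal M G
    by (simp add: minimal_normal_def)
  have trans: "acts_transitively M"
    using M by (rule minimal_normal_transitive)
  show ?thesis
  proof (cases "centralizer G M = {\<one>}")
    case True
    then show ?thesis
      using M M.one_closed by (auto simp: comm_group_iff_subset_centralizer M.subgroup_axioms minimal_normal_def)
  next
    case False
    then obtain N where "minimal_normal N G" "N \<subseteq> centralizer G M"
      using exists_minimal_normal assms(1) centralizer_normal M.normal_axioms by metis
    then have "M \<subseteq> centralizer G M"
      using uniq by auto
    then show ?thesis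
      using trans centralizer_semiregular[OF trans M.subset]
      by (auto simp: comm_group_iff_subset_centralizer M.subgroup_axioms acts_semiregularly_def)
  qed
qed

section \<open>The diagonal subgroup in the product of two minimal normal subgroups\<close>

context
  fixes M\<^sub>1 M\<^sub>2
  assumes min: "minimal_normal M\<^sub>1 G" "minimal_normal M\<^sub>2 G" and distinct: "M\<^sub>1 \<noteq> M\<^sub>2"
begin

interpretation M1: normal M\<^sub>1 G
  using min by (simp add: minimal_normal_def)

interpretation M2: normal M\<^sub>2 G
  using min by (simp add: minimal_normal_def)

text \<open>Since \<open>M\<^sub>2\<close> is regular, each \<open>x\<close> in
  \<open>M\<^sub>1\<close> has exactly one partner \<open>y\<close> in \<open>M\<^sub>2\<close> that
  sends \<open>\<alpha>\<close> where \<open>inv x\<close> does; this partner is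
  \<open>\<theta> x\<close>.\<close>

lemma diagonal_map_exists:
  obtains \<theta> where "\<And>x y. x \<in> M\<^sub>1 \<Longrightarrow> y \<in> M\<^sub>2 \<Longrightarrow> \<phi> (x \<otimes> y) \<alpha> = \<alpha> \<longleftrightarrow> y = \<theta> x"
    and "\<theta> \<in> iso (G\<lparr>carrier := M\<^sub>1\<rparr>) (G\<lparr>carrier := M\<^sub>2\<rparr>)"
proof -
  have comm: "x \<otimes> y = y \<otimes> x" if "x \<in> M\<^sub>1" "y \<in> M\<^sub>2" for x y
    using distinct_minimal_normal_commute[OF min distinct] that .
  have fix_iff: "\<phi> (x \<otimes> y) \<alpha> = \<alpha> \<longleftrightarrow> \<phi> y \<alpha> = \<phi> (inv x) \<alpha>"
    if "x \<in> carrier G" "y \<in> carrier G" for x y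
    using that point
    by (metis composition_rule element_image inv_closed inv_inv orbit_sym_aux)
  \<comment> \<open>Stated for any ordered pair because it is used in both directions: once to
    define \<open>\<theta>\<close>, once with the roles exchanged to invert it.\<close>
  have ex1: "\<exists>!y. y \<in> N \<and> \<phi> (x \<otimes> y) \<alpha> = \<alpha>"
    if "minimal_normal M G" "minimal_normal N G" "M \<noteq> N" "x \<in> carrier G" for x M N
  proof -
    have N: "subgroup N G"
      using that by (simp add: minimal_normal_def normal_imp_subgroup)
    have "\<phi> (inv x) \<alpha> \<in> E"
      using that element_image point by blast
    then have "\<exists>y\<in>N. \<phi> y \<alpha> = \<phi> (inv x) \<alpha>"
      using minimal_normal_transitive that point unfolding acts_transitively_def by blast
    moreover have "acts_semiregularly N"
      using distinct_minimal_normal_semiregular that by blast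
    ultimately show ?thesis
      using semiregular_inj[OF _ N] fix_iff that point subgroup.mem_carrier[OF N] by metis
  qed
  define \<theta> where "\<theta> x = (THE y. y \<in> M\<^sub>2 \<and> \<phi> (x \<otimes> y) \<alpha> = \<alpha>)" for x
  have \<theta>: "\<theta> x \<in> M\<^sub>2 \<and> \<phi> (x \<otimes> \<theta> x) \<alpha> = \<alpha>" if "x \<in> M\<^sub>1" for x
    using theI'[OF ex1[OF min distinct, of x]] that by (simp add: \<theta>_def)
  have \<theta>_iff: "\<phi> (x \<otimes> y) \<alpha> = \<alpha> \<longleftrightarrow> y = \<theta> x" if "x \<in> M\<^sub>1" "y \<in> M\<^sub>2" for x y
    using ex1[OF min distinct, of x] \<theta>[of x] that by auto
  have "\<theta> \<in> iso (G\<lparr>carrier := M\<^sub>1\<rparr>) (G\<lparr>carrier := M\<^sub>2\<rparr>)"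
  proof (rule isoI)
    \<comment> \<open>The product of two elements fixing \<open>\<alpha>\<close> fixes
      \<open>\<alpha>\<close>; regrouping it by commutation exhibits
      \<open>\<theta> x \<otimes> \<theta> x'\<close> as the partner of
      \<open>x \<otimes> x'\<close>.\<close>
    have "\<theta> (x \<otimes> x') = \<theta> x \<otimes> \<theta> x'" if x: "x \<in> M\<^sub>1" "x' \<in> M\<^sub>1" for x x'
    proof -
      have "(x \<otimes> x') \<otimes> (\<theta> x \<otimes> \<theta> x') = (x \<otimes> \<theta> x) \<otimes> (x' \<otimes> \<theta> x')"
        using x \<theta> by (intro mult_mult_swap) (auto intro: comm)
      then have "\<phi> ((x \<otimes> x') \<otimes> (\<theta> x \<otimes> \<theta> x')) \<alpha> = \<alpha>"
        using x \<theta> point composition_rule[OF point, of "x \<otimes> \<theta> x" "x' \<otimes> \<theta> x'"] by auto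
      then show ?thesis
        using \<theta>_iff[of "x \<otimes> x'" "\<theta> x \<otimes> \<theta> x'"] x \<theta> by auto
    qed
    then show "\<theta> \<in> hom (G\<lparr>carrier := M\<^sub>1\<rparr>) (G\<lparr>carrier := M\<^sub>2\<rparr>)"
      using \<theta> by (auto intro!: homI)
    have "\<exists>!x. x \<in> M\<^sub>1 \<and> y = \<theta> x" if "y \<in> M\<^sub>2" for y
      using ex1[OF min(2,1) distinct[symmetric], of y] comm \<theta>_iff that
      by (metis M2.mem_carrier)
    then have "inj_on \<theta> M\<^sub>1" "\<theta> ` M\<^sub>1 = M\<^sub>2"
      using \<theta> by (auto simp: inj_on_def image_iff) metis
    then show "bij_betw \<theta> (carrier (G\<lparr>carrier := M\<^sub>1\<rparr>)) (carrier (G\<lparr>carrier := M\<^sub>2\<rparr>))"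
      by (simp add: bij_betw_def)
  qed
  then show ?thesis
    using that \<theta>_iff by blast
qed

text \<open>All claims rest on \<open>M\<^sub>0\<close> being the graph of \<open>\<theta>\<close>:
  the first projection is inverted by \<open>x \<mapsto> x \<otimes> \<theta> x\<close>, the second
  is \<open>\<theta>\<close> after the first, and minimality of \<open>M\<^sub>0\<close> in the
  stabilizer is reduced to minimality of \<open>M\<^sub>1\<close> in \<open>G\<close>.\<close>

lemma two_minimal_normal:
  defines "M\<^sub>0 \<equiv> stabilizer G \<phi> \<alpha> \<inter> generate G (M\<^sub>1 \<union> M\<^sub>2)"
  shows "minimal_normal M\<^sub>0 (G\<lparr>carrier := stabilizer G \<phi> \<alpha>\<rparr>)"
    and "proj_fst G M\<^sub>1 M\<^sub>2 \<in> iso (G\<lparr>carrier := M\<^sub>0\<rparr>) (G\<lparr>carrier := M\<^sub>1\<rparr>)"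
    and "proj_snd G M\<^sub>1 M\<^sub>2 \<in> iso (G\<lparr>carrier := M\<^sub>0\<rparr>) (G\<lparr>carrier := M\<^sub>2\<rparr>)"
    and "\<exists>\<theta> \<in> iso (G\<lparr>carrier := M\<^sub>1\<rparr>) (G\<lparr>carrier := M\<^sub>2\<rparr>). M\<^sub>0 = {x \<otimes> \<theta> x | x. x \<in> M\<^sub>1}"
proof -
  let ?H = "stabilizer G \<phi> \<alpha>"
  obtain \<theta> where \<theta>_iff: "\<And>x y. x \<in> M\<^sub>1 \<Longrightarrow> y \<in> M\<^sub>2 \<Longrightarrow> \<phi> (x \<otimes> y) \<alpha> = \<alpha> \<longleftrightarrow> y = \<theta> x"
    and \<theta>_iso: "\<theta> \<in> iso (G\<lparr>carrier := M\<^sub>1\<rparr>) (G\<lparr>carrier := M\<^sub>2\<rparr>)"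
    using diagonal_map_exists by blast
  have comm: "x \<otimes> y = y \<otimes> x" if "x \<in> M\<^sub>1" "y \<in> M\<^sub>2" for x y
    using distinct_minimal_normal_commute[OF min distinct] that .
  have \<theta>_bij: "bij_betw \<theta> M\<^sub>1 M\<^sub>2" and \<theta>_mult: "\<And>x y. x \<in> M\<^sub>1 \<Longrightarrow> y \<in> M\<^sub>1 \<Longrightarrow> \<theta> (x \<otimes> y) = \<theta> x \<otimes> \<theta> y"
    using \<theta>_iso by (auto simp: iso_def hom_def)
  then have \<theta>_closed [simp]: "x \<in> M\<^sub>1 \<Longrightarrow> \<theta> x \<in> M\<^sub>2" for x
    by (auto simp: bij_betw_def)
  have gen: "generate G (M\<^sub>1 \<union> M\<^sub>2) = {x \<otimes> y | x y. x \<in> M\<^sub>1 \<and> y \<in> M\<^sub>2}"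
    using M1.subgroup_axioms M2.subgroup_axioms minimal_normal_Int[OF min distinct] comm
    by (rule mult_map_iso(2))
  have M0_eq: "M\<^sub>0 = {x \<otimes> \<theta> x | x. x \<in> M\<^sub>1}"
  proof (intro equalityI subsetI)
    fix g assume "g \<in> M\<^sub>0"
    then obtain x y where "x \<in> M\<^sub>1" "y \<in> M\<^sub>2" "g = x \<otimes> y" "\<phi> (x \<otimes> y) \<alpha> = \<alpha>"
      by (auto simp: M\<^sub>0_def gen stabilizer_def)
    then show "g \<in> {x \<otimes> \<theta> x | x. x \<in> M\<^sub>1}"
      using \<theta>_iff by blast
  next
    fix g assume "g \<in> {x \<otimes> \<theta> x | x. x \<in> M\<^sub>1}"
    then obtain x where "x \<in> M\<^sub>1" "g = x \<otimes> \<theta> x"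
      by blast
    then show "g \<in> M\<^sub>0"
      using \<theta>_iff[of x "\<theta> x"] \<theta>_closed by (fastforce simp: M\<^sub>0_def gen stabilizer_def)
  qed
  then show "\<exists>\<theta> \<in> iso (G\<lparr>carrier := M\<^sub>1\<rparr>) (G\<lparr>carrier := M\<^sub>2\<rparr>). M\<^sub>0 = {x \<otimes> \<theta> x | x. x \<in> M\<^sub>1}"
    using \<theta>_iso by blast
  have mult: "(x \<otimes> y) \<otimes> (x' \<otimes> y') = (x \<otimes> x') \<otimes> (y \<otimes> y')"
    if "x \<in> M\<^sub>1" "x' \<in> M\<^sub>1" "y \<in> M\<^sub>2" "y' \<in> M\<^sub>2" for x x' y y'
    using that by (intro mult_mult_swap) (auto intro: comm[symmetric])
  have proj: "proj_fst G M\<^sub>1 M\<^sub>2 (x \<otimes> y) = x" "proj_snd G M\<^sub>1 M\<^sub>2 (x \<otimes> y) = y"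
    if "x \<in> M\<^sub>1" "y \<in> M\<^sub>2" for x y
    using proj_mult[OF M1.subgroup_axioms M2.subgroup_axioms minimal_normal_Int[OF min distinct]]
      comm that by auto
  show fst: "proj_fst G M\<^sub>1 M\<^sub>2 \<in> iso (G\<lparr>carrier := M\<^sub>0\<rparr>) (G\<lparr>carrier := M\<^sub>1\<rparr>)"
  proof (intro isoI homI)
    show "bij_betw (proj_fst G M\<^sub>1 M\<^sub>2) (carrier (G\<lparr>carrier := M\<^sub>0\<rparr>)) (carrier (G\<lparr>carrier := M\<^sub>1\<rparr>))"
      by (rule bij_betwI[where g = "\<lambda>x. x \<otimes> \<theta> x"]) (auto simp: M0_eq proj)
  qed (auto simp: M0_eq proj mult)
  show "proj_snd G M\<^sub>1 M\<^sub>2 \<in> iso (G\<lparr>carrier := M\<^sub>0\<rparr>) (G\<lparr>carrier := M\<^sub>2\<rparr>)"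
  proof (intro isoI homI)
    have "bij_betw (proj_snd G M\<^sub>1 M\<^sub>2) M\<^sub>0 M\<^sub>2 \<longleftrightarrow> bij_betw (\<theta> \<circ> proj_fst G M\<^sub>1 M\<^sub>2) M\<^sub>0 M\<^sub>2"
      by (rule bij_betw_cong) (auto simp: M0_eq proj)
    then show "bij_betw (proj_snd G M\<^sub>1 M\<^sub>2) (carrier (G\<lparr>carrier := M\<^sub>0\<rparr>)) (carrier (G\<lparr>carrier := M\<^sub>2\<rparr>))"
      using fst \<theta>_bij by (auto simp: iso_def intro: bij_betw_trans)
  qed (auto simp: M0_eq proj mult)
  have H: "subgroup ?H G"
    by (rule stabilizer_subgroup[OF point])
  have conj: "g \<otimes> (x \<otimes> y) \<otimes> inv g = (g \<otimes> x \<otimes> inv g) \<otimes> (g \<otimes> y \<otimes> inv g)"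
    if "x \<in> carrier G" "y \<in> carrier G" "g \<in> carrier G" for x y g
    using that by (simp add: m_assoc inv_mult_cancel)
  have "generate G (M\<^sub>1 \<union> M\<^sub>2) \<lhd> G"
    using M1.subset M2.subset M1.inv_op_closed2 M2.inv_op_closed2 by (intro normal_generateI) auto
  then have "M\<^sub>0 \<lhd> G\<lparr>carrier := ?H\<rparr>"
    unfolding M\<^sub>0_def by (subst Int_commute) (rule normal_Int_subgroup[OF H])
  moreover have "M\<^sub>0 \<noteq> {\<one>}"
  proof
    assume "M\<^sub>0 = {\<one>}"
    then have "proj_fst G M\<^sub>1 M\<^sub>2 ` {\<one>} = M\<^sub>1"
      using fst by (auto simp: iso_def bij_betw_def)
    then have "M\<^sub>1 = {\<one>}"
      using M1.one_closed by (metis image_empty image_insert singletonD)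
    moreover have "M\<^sub>1 \<noteq> {\<one>}"
      using min(1) unfolding minimal_normal_def by (elim conjE)
    ultimately show False
      by contradiction
  qed
  moreover have "L = M\<^sub>0" if L: "L \<lhd> G\<lparr>carrier := ?H\<rparr>" "L \<noteq> {\<one>}" "L \<subseteq> M\<^sub>0" for L
  proof -
    \<comment> \<open>The projection of \<open>L\<close> to \<open>M\<^sub>1\<close> is normalised by \<open>H\<close> and centralised by \<open>M\<^sub>2\<close>, hence normal
      in \<open>G = M\<^sub>2 H\<close>.\<close>
    interpret L: subgroup L G
      using L(1) by (simp add: normal_in_subgroup_iff[OF H])
    have L_conj: "h \<otimes> l \<otimes> inv h \<in> L" if "h \<in> ?H" "l \<in> L" for h l
      using L(1) that by (simp add: normal_in_subgroup_iff[OF H])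
    \<comment> \<open>As \<open>L\<close> lies in the graph of \<open>\<theta>\<close>, its image
      under the first projection consists of the \<open>x\<close> whose graph point belongs to
      \<open>L\<close>.\<close>
    define L1 where "L1 = {x \<in> M\<^sub>1. x \<otimes> \<theta> x \<in> L}"
    have \<theta>_one: "\<theta> \<one> = \<one>"
      using \<theta>_iff[of \<one> \<one>] stabilizer_one_closed[OF point] by (simp add: stabilizer_def)
    have "L1 \<lhd> G"
    proof (rule normal_invI)
      show "subgroup L1 G"
      proof (rule subgroupI)
        have "\<one> \<in> L1"
          using \<theta>_one by (simp add: L1_def)
        then show "L1 \<noteq> {}"
          by blast
        show "x \<otimes> y \<in> L1" if "x \<in> L1" "y \<in> L1" for x y
          using that L.m_closed[of "x \<otimes> \<theta> x" "y \<otimes> \<theta> y"] by (auto simp: L1_def mult \<theta>_mult)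
        show "inv x \<in> L1" if "x \<in> L1" for x
        proof -
          have x: "x \<in> M\<^sub>1" "x \<otimes> \<theta> x \<in> L"
            using that by (auto simp: L1_def)
          then have "\<theta> (inv x) \<otimes> \<theta> x = \<one>"
            using \<theta>_mult[of "inv x" x] \<theta>_one by simp
          then have "\<theta> (inv x) = inv (\<theta> x)"
            using x inv_equality by simp
          then have "inv x \<otimes> \<theta> (inv x) = inv (x \<otimes> \<theta> x)"
            using x comm[of "inv x" "inv (\<theta> x)"] by (simp add: inv_mult_group)
          then show ?thesis
            using x by (simp add: L1_def)
        qed
      qed (auto simp: L1_def)
    next
      fix g x assume g: "g \<in> carrier G" and "x \<in> L1"
      then have x: "x \<in> M\<^sub>1" "x \<otimes> \<theta> x \<in> L"
        by (auto simp: L1_def)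
      obtain m h where mh: "m \<in> M\<^sub>2" "h \<in> ?H" "g = m \<otimes> h"
        using transitive_factorization[OF minimal_normal_transitive[OF min(2)]
            M2.subgroup_axioms point g] .
      have h: "h \<in> carrier G"
        using mh by (simp add: stabilizer_def)
      let ?x = "h \<otimes> x \<otimes> inv h"
      have x': "?x \<in> M\<^sub>1"
        using M1.inv_op_closed2 h x by blast
      have "?x \<otimes> (h \<otimes> \<theta> x \<otimes> inv h) \<in> L"
        using L_conj[OF mh(2) x(2)] conj h x by simp
      \<comment> \<open>The conjugated graph point is still in \<open>L\<close>, hence in
        \<open>M\<^sub>0\<close>, so it fixes \<open>\<alpha>\<close>; its second factor is
        therefore determined by its first.\<close>
      moreover from this have "h \<otimes> \<theta> x \<otimes> inv h = \<theta> ?x"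
        using \<theta>_iff[OF x', of "h \<otimes> \<theta> x \<otimes> inv h"] M2.inv_op_closed2 h x \<open>L \<subseteq> M\<^sub>0\<close>
        by (auto simp: M\<^sub>0_def stabilizer_def)
      ultimately have "?x \<in> L1"
        using x' by (simp add: L1_def)
      moreover have "g \<otimes> x \<otimes> inv g = m \<otimes> ?x \<otimes> inv m"
        using mh h x by (simp add: inv_mult_group m_assoc)
      moreover have "m \<otimes> ?x \<otimes> inv m = ?x"
        using comm[OF x' mh(1)] mh h x by (metis M1.mem_carrier M2.mem_carrier inv_solve_right' m_closed x')
      ultimately show "g \<otimes> x \<otimes> inv g \<in> L1"
        by simp
    qed
    moreover have "L1 \<noteq> {\<one>}"
    proof
      assume L1: "L1 = {\<one>}"
      have "l = \<one>" if "l \<in> L" for l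
      proof -
        have "l \<in> M\<^sub>0"
          using that \<open>L \<subseteq> M\<^sub>0\<close> by blast
        then obtain x where x: "x \<in> M\<^sub>1" "l = x \<otimes> \<theta> x"
          by (auto simp: M0_eq)
        then have "x \<in> L1"
          using \<open>l \<in> L\<close> by (simp add: L1_def)
        then show ?thesis
          using x(2) L1 \<theta>_one by simp
      qed
      then show False
        using \<open>L \<noteq> {\<one>}\<close> L.one_closed by blast
    qed
    ultimately have "L1 = M\<^sub>1"
      using min(1) unfolding minimal_normal_def by (simp add: L1_def)
    then have "x \<otimes> \<theta> x \<in> L" if "x \<in> M\<^sub>1" for x
      using that unfolding L1_def by blast
    then have "M\<^sub>0 \<subseteq> L"
      by (auto simp: M0_eq)
    with \<open>L \<subseteq> M\<^sub>0\<close> show ?thesis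
      by (rule subset_antisym)
  qed
  ultimately show "minimal_normal M\<^sub>0 (G\<lparr>carrier := ?H\<rparr>)"
    by (simp add: minimal_normal_def)
qed

end

end


section \<open>The action of a quotient on the orbits of a normal subgroup\<close>

context group
begin

text \<open>Conjugation induces only finitely many self-maps of \<open>N\<close>, so infinitely many
  elements induce the same map as some \<open>a\<close>. Translating them by \<open>inv a\<close>
  puts them into the centralizer.\<close>

lemma finite_normal_infinite_centralizer:
  assumes "infinite (carrier G)" "N \<lhd> G" "finite N"
  shows "infinite (centralizer G N)"
proof -
  interpret N: normal N G by fact
  \<comment> \<open>The restriction to \<open>N\<close> places the values in the extensional
    function space, which is finite.\<close>
  define f where "f g = (\<lambda>n\<in>N. g \<otimes> n \<otimes> inv g)" for g
  have "f ` carrier G \<subseteq> N \<rightarrow>\<^sub>E N"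
    using N.inv_op_closed2 by (auto simp: f_def)
  then have "finite (f ` carrier G)"
    using \<open>finite N\<close> finite_PiE finite_subset by metis
  then obtain a where a: "a \<in> carrier G" and inf: "infinite {g \<in> carrier G. f g = f a}"
    using pigeonhole_infinite[OF assms(1)] by metis
  have "inv a \<otimes> g \<in> centralizer G N" if g: "g \<in> carrier G" "f g = f a" for g
  proof -
    have "inv a \<otimes> g \<otimes> n = n \<otimes> (inv a \<otimes> g)" if n: "n \<in> N" for n
    proof -
      have "g \<otimes> n \<otimes> inv g = a \<otimes> n \<otimes> inv a"
        using fun_cong[OF g(2), of n] n by (simp add: f_def)
      then have "inv a \<otimes> (g \<otimes> n \<otimes> inv g) \<otimes> g = inv a \<otimes> (a \<otimes> n \<otimes> inv a) \<otimes> g"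
        by simp
      moreover have "inv a \<otimes> (g \<otimes> n \<otimes> inv g) \<otimes> g = inv a \<otimes> g \<otimes> n"
        using a g n by (simp add: m_assoc)
      moreover have "inv a \<otimes> (a \<otimes> n \<otimes> inv a) \<otimes> g = n \<otimes> (inv a \<otimes> g)"
        using a g n by (simp add: m_assoc inv_mult_cancel)
      ultimately show ?thesis
        by simp
    qed
    then show ?thesis
      using a g by (simp add: centralizer_def)
  qed
  then have "(\<lambda>g. inv a \<otimes> g) ` {g \<in> carrier G. f g = f a} \<subseteq> centralizer G N"
    by auto
  moreover have "inj_on (\<lambda>g. inv a \<otimes> g) {g \<in> carrier G. f g = f a}"
    using a by (auto intro: inj_onI)
  ultimately show ?thesis
    using inf finite_subset finite_imageD by metis
qed

text \<open>The union of the cosets in a finite normal subgroup of the quotient is its preimage in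
  \<open>G\<close>. It is a finite normal subgroup containing \<open>K\<close>, so it equals
  \<open>K\<close> by maximality.\<close>

lemma normally_infinite_Mod:
  assumes K: "maximal_finite_normal K G"
  shows "normally_infinite (G Mod K)"
  unfolding normally_infinite_def
proof (intro allI impI notI)
  fix N assume N: "N \<lhd> G Mod K \<and> N \<noteq> {\<one>\<^bsub>G Mod K\<^esub>}" and "finite N"
  interpret K: normal K G
    using K by (simp add: maximal_finite_normal_def)
  interpret N: normal N "G Mod K"
    using N by simp
  have coset: "\<exists>g\<in>carrier G. C = K #> g" if "C \<in> N" for C
    using N.subset that by (auto simp: carrier_FactGroup)
  have "finite K"
    using K by (simp add: maximal_finite_normal_def)
  then have "finite C" if "C \<in> N" for C
    using coset[OF that] by (auto simp: r_coset_def)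
  then have "finite (\<Union>N)"
    using \<open>finite N\<close> by blast
  moreover have "\<Union>N \<lhd> G"
    using K.factgroup_subgroup_union_normal N by blast
  moreover have "K \<in> N"
    using subgroup.one_closed[OF N.subgroup_axioms] by simp
  then have "K \<subseteq> \<Union>N"
    by blast
  ultimately have "\<Union>N = K"
    using K by (simp add: maximal_finite_normal_def)
  have "C = K" if C: "C \<in> N" for C
  proof -
    obtain g where g: "g \<in> carrier G" "C = K #> g"
      using coset[OF C] by blast
    then have "g \<in> \<Union>N"
      using C rcos_self[OF g(1) K.subgroup_axioms] by blast
    then show ?thesis
      using g \<open>\<Union>N = K\<close> coset_join2[OF g(1) K.subgroup_axioms] by simp
  qed
  then have "N = {K}"
    using \<open>K \<in> N\<close> by blast
  then show False
    using N by simp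
qed

section \<open>Cosets of a normal subgroup and the second isomorphism theorem\<close>

lemma r_coset_mult_right:
  assumes "K \<lhd> G" "h \<in> carrier G" "k \<in> K"
  shows "K #> (h \<otimes> k) = K #> h"
proof -
  interpret K: normal K G by fact
  have "h \<otimes> k \<in> K #> h"
    using assms K.coset_eq by (auto simp: l_coset_def)
  then show ?thesis
    using repr_independence assms K.subgroup_axioms by metis
qed

lemma r_cosets_set_mult:
  assumes "K \<lhd> G" "H \<subseteq> carrier G"
  shows "(\<lambda>g. K #> g) ` (H <#> K) = (\<lambda>h. K #> h) ` H"
proof -
  interpret K: normal K G by fact
  have "K #> (h \<otimes> k) = K #> h" if "h \<in> H" "k \<in> K" for h k
    using r_coset_mult_right[OF assms(1)] assms(2) that by blast
  then have "(\<lambda>g. K #> g) ` (H <#> K) = (\<Union>h\<in>H. \<Union>k\<in>K. {K #> h})"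
    unfolding set_mult_def by (simp add: image_UN)
  also have "\<dots> = (\<lambda>h. K #> h) ` H"
    using subgroup_nonempty[of G] K.subgroup_axioms by auto
  finally show ?thesis .
qed

text \<open>This is the second isomorphism theorem when \<open>H \<inter> K\<close>, the kernel of
  passing to cosets on \<open>H\<close>, is trivial.\<close>

lemma r_coset_iso_Mod:
  assumes K: "K \<lhd> G" and H: "subgroup H G" and "H \<inter> K = {\<one>}"
  shows "(\<lambda>h. K #> h) \<in> iso (G\<lparr>carrier := H\<rparr>) (G\<lparr>carrier := H <#> K\<rparr> Mod K)"
proof -
  interpret K: normal K G by fact
  interpret H: subgroup H G by fact
  have carrier: "carrier (G\<lparr>carrier := H <#> K\<rparr> Mod K) = (\<lambda>h. K #> h) ` H"
    using r_cosets_set_mult[OF K H.subset] by (simp add: carrier_FactGroup)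
  show ?thesis
  proof (intro isoI homI)
    have "g = h" if "g \<in> H" "h \<in> H" "K #> g = K #> h" for g h
    proof -
      have "g \<otimes> inv h \<in> K"
        using that rcos_self[OF _ K.subgroup_axioms, of g]
          K.rcos_module_imp[OF group_axioms, of h g] by simp
      moreover have "g \<otimes> inv h \<in> H"
        using that by simp
      ultimately have "g \<otimes> inv h = \<one>"
        using \<open>H \<inter> K = {\<one>}\<close> by blast
      then show ?thesis
        using that by (metis H.mem_carrier inv_closed inv_equality inv_inv)
    qed
    then show "bij_betw (\<lambda>h. K #> h) (carrier (G\<lparr>carrier := H\<rparr>)) (carrier (G\<lparr>carrier := H <#> K\<rparr> Mod K))"
      unfolding carrier by (intro bij_betw_imageI inj_onI) auto
  qed (simp_all add: carrier K.rcos_sum)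
qed

end

text \<open>\<open>K\<close> lies in its double centralizer, which is semiregular because the
  centralizer of \<open>K\<close> is infinite and normal, hence transitive.\<close>

lemma (in faithful_action) finite_normal_semiregular:
  assumes "infinite (carrier G)" and "\<And>N. N \<lhd> G \<Longrightarrow> infinite N \<Longrightarrow> acts_transitively N"
    and "K \<lhd> G" "finite K"
  shows "acts_semiregularly K"
proof -
  interpret K: normal K G by fact
  have "acts_transitively (centralizer G K)"
    using assms centralizer_normal finite_normal_infinite_centralizer by blast
  then have "acts_semiregularly (centralizer G (centralizer G K))"
    by (rule centralizer_semiregular) (auto simp: centralizer_def)
  moreover have "K \<subseteq> centralizer G (centralizer G K)"
    by (auto simp: centralizer_def)
  ultimately show ?thesis
    unfolding acts_semiregularly_def by blast
qed

section \<open>The actions of a group and its quotient on the orbits of a normal subgroup\<close>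

context group_action
begin

abbreviation blocks :: "'a set \<Rightarrow> 'c set set" where
  "blocks K \<equiv> orbits (G\<lparr>carrier := K\<rparr>) E \<phi>"

text \<open>An intermediate action of \<open>G\<close> itself: the action laws are verified on
  elements and then transferred to cosets by choosing representatives.\<close>

definition orbit_action :: "'a set \<Rightarrow> 'a \<Rightarrow> 'c set \<Rightarrow> 'c set" where
  "orbit_action K g = (\<lambda>B\<in>blocks K. \<phi> g ` B)"

text \<open>The analogue of \<open>block_action\<close> for an arbitrary action; taking the union
  over the coset avoids choosing a representative.\<close>

definition coset_action :: "'a set \<Rightarrow> 'a set \<Rightarrow> 'c set \<Rightarrow> 'c set" where
  "coset_action K C = (\<lambda>B\<in>blocks K. \<Union>c\<in>C. \<phi> c ` B)"

context
  fixes K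
  assumes K: "K \<lhd> G"
begin

interpretation K: normal K G by (rule K)

interpretation KA: group_action "G\<lparr>carrier := K\<rparr>" E \<phi>
  by (rule induced_action[OF K.subgroup_axioms])

text \<open>Moving \<open>g\<close> past \<open>k\<close> replaces \<open>k\<close> by
  \<open>g \<otimes> k \<otimes> inv g\<close>, and conjugation by \<open>g\<close> permutes
  \<open>K\<close>.\<close>

lemma image_orbit:
  assumes "g \<in> carrier G" "x \<in> E"
  shows "\<phi> g ` orbit (G\<lparr>carrier := K\<rparr>) \<phi> x = orbit (G\<lparr>carrier := K\<rparr>) \<phi> (\<phi> g x)"
proof -
  have orbit: "orbit (G\<lparr>carrier := K\<rparr>) \<phi> y = (\<lambda>k. \<phi> k y) ` K" for y
    by (auto simp: orbit_def)
  have "\<phi> g (\<phi> k x) = \<phi> (g \<otimes> k \<otimes> inv g) (\<phi> g x)" if "k \<in> K" for k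
  proof -
    have "\<phi> (g \<otimes> k \<otimes> inv g) (\<phi> g x) = \<phi> ((g \<otimes> k \<otimes> inv g) \<otimes> g) x"
      using that assms by (subst composition_rule) auto
    also have "(g \<otimes> k \<otimes> inv g) \<otimes> g = g \<otimes> k"
      using that assms by (simp add: m_assoc)
    finally show ?thesis
      using that assms by (simp add: composition_rule)
  qed
  then have "\<phi> g ` (\<lambda>k. \<phi> k x) ` K = (\<lambda>k. \<phi> k (\<phi> g x)) ` (\<lambda>k. g \<otimes> k \<otimes> inv g) ` K"
    unfolding image_image by (rule image_cong[OF refl])
  also have "(\<lambda>k. g \<otimes> k \<otimes> inv g) ` K = K"
  proof (intro equalityI subsetI)
    fix k assume "k \<in> K"
    then have "inv g \<otimes> k \<otimes> g \<in> K" "k = g \<otimes> (inv g \<otimes> k \<otimes> g) \<otimes> inv g"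
      using K.inv_op_closed1 assms by (simp_all add: m_assoc inv_mult_cancel)
    then show "k \<in> (\<lambda>k. g \<otimes> k \<otimes> inv g) ` K"
      by (rule rev_image_eqI)
  qed (use K.inv_op_closed2 assms in auto)
  finally show ?thesis
    by (simp only: orbit)
qed

lemma orbit_fixed:
  assumes "k \<in> K" "x \<in> E"
  shows "orbit (G\<lparr>carrier := K\<rparr>) \<phi> (\<phi> k x) = orbit (G\<lparr>carrier := K\<rparr>) \<phi> x"
proof -
  have "\<phi> k x \<in> E"
    using element_image[OF K.mem_carrier[OF assms(1)] assms(2) refl] .
  then have "\<phi> k x \<in> orbit (G\<lparr>carrier := K\<rparr>) \<phi> x" "\<phi> k x \<in> orbit (G\<lparr>carrier := K\<rparr>) \<phi> (\<phi> k x)"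
    using assms KA.orbit_refl by (auto simp: orbit_def)
  then show ?thesis
    using KA.disjoint_union \<open>\<phi> k x \<in> E\<close> assms unfolding orbits_def by blast
qed

lemma blocks_subset: "B \<in> blocks K \<Longrightarrow> B \<subseteq> E"
  using KA.orbits_coverture by blast

lemma image_block:
  assumes "g \<in> carrier G" "B \<in> blocks K"
  shows "\<phi> g ` B \<in> blocks K"
proof -
  obtain x where x: "x \<in> E" "B = orbit (G\<lparr>carrier := K\<rparr>) \<phi> x"
    using assms(2) by (auto simp: orbits_def)
  then have "\<phi> g ` B = orbit (G\<lparr>carrier := K\<rparr>) \<phi> (\<phi> g x)"
    using image_orbit assms(1) by simp
  then show ?thesis
    using element_image[OF assms(1) x(1) refl] by (auto simp: orbits_def)
qed

lemma image_block_normal: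
  assumes "k \<in> K" "B \<in> blocks K"
  shows "\<phi> k ` B = B"
proof -
  obtain x where "x \<in> E" "B = orbit (G\<lparr>carrier := K\<rparr>) \<phi> x"
    using assms(2) by (auto simp: orbits_def)
  then show ?thesis
    using image_orbit[OF K.mem_carrier[OF assms(1)]] orbit_fixed[OF assms(1)] by metis
qed

lemma image_comp:
  assumes "g \<in> carrier G" "h \<in> carrier G" "B \<subseteq> E"
  shows "\<phi> (g \<otimes> h) ` B = \<phi> g ` \<phi> h ` B"
  unfolding image_image using assms by (intro image_cong) (auto simp: composition_rule)

lemma orbit_action_group_action: "group_action G (blocks K) (orbit_action K)"
proof -
  have inverse: "\<phi> (inv g) ` \<phi> g ` B = B" "\<phi> g ` \<phi> (inv g) ` B = B"
    if "g \<in> carrier G" "B \<in> blocks K" for g B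
    using that image_comp[of "inv g" g B] image_comp[of g "inv g" B] blocks_subset[of B]
      image_block_normal[OF K.one_closed, of B] by simp_all
  have Bij: "orbit_action K g \<in> Bij (blocks K)" if "g \<in> carrier G" for g
  proof -
    have "bij_betw (orbit_action K g) (blocks K) (blocks K)"
      using that by (intro bij_betwI[where g = "\<lambda>B. \<phi> (inv g) ` B"])
        (auto simp: orbit_action_def image_block inverse)
    then show ?thesis
      by (simp add: Bij_def orbit_action_def)
  qed
  moreover have "orbit_action K (g \<otimes> h) = compose (blocks K) (orbit_action K g) (orbit_action K h)"
    if "g \<in> carrier G" "h \<in> carrier G" for g h
    using that by (intro ext)
      (auto simp: orbit_action_def compose_def image_comp blocks_subset image_block)
  ultimately have "orbit_action K \<in> hom G (BijGroup (blocks K))"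
    by (intro homI) (simp_all add: BijGroup_def)
  then show ?thesis
    by (simp add: group_action_def group_hom_def group_hom_axioms_def group_BijGroup)
qed

lemma orbit_action_eq_one_iff:
  "orbit_action K g = \<one>\<^bsub>BijGroup (blocks K)\<^esub> \<longleftrightarrow> (\<forall>B\<in>blocks K. \<phi> g ` B = B)"
proof -
  have "(\<lambda>B\<in>blocks K. \<phi> g ` B) = (\<lambda>B\<in>blocks K. B) \<longleftrightarrow> (\<forall>B\<in>blocks K. \<phi> g ` B = B)"
    by (metis (no_types, lifting) restrict_apply' restrict_ext)
  then show ?thesis
    by (simp add: orbit_action_def BijGroup_def)
qed

text \<open>All elements of \<open>K #> g\<close> send a block to the same block, since
  \<open>K\<close> maps each block to itself; the union thus has equal members.\<close>

lemma coset_action_eq: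
  assumes "g \<in> carrier G"
  shows "coset_action K (K #> g) = orbit_action K g"
proof -
  have "(\<Union>c\<in>K #> g. \<phi> c ` B) = \<phi> g ` B" if B: "B \<in> blocks K" for B
  proof -
    have "\<phi> (k \<otimes> g) ` B = \<phi> g ` B" if "k \<in> K" for k
      using that assms B image_comp[of k g B] blocks_subset[OF B] image_block image_block_normal
      by auto
    then have "(\<Union>k\<in>K. \<phi> (k \<otimes> g) ` B) = (\<Union>k\<in>K. \<phi> g ` B)"
      by (rule SUP_cong[OF refl])
    also have "\<dots> = \<phi> g ` B"
      using K.one_closed by blast
    finally show ?thesis
      by (simp add: r_coset_def)
  qed
  then show ?thesis
    unfolding coset_action_def orbit_action_def by (rule restrict_ext)
qed

lemma coset_action_group_action: "group_action (G Mod K) (blocks K) (coset_action K)"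
proof -
  interpret O: group_action G "blocks K" "orbit_action K"
    by (rule orbit_action_group_action)
  have "coset_action K \<in> hom (G Mod K) (BijGroup (blocks K))"
  proof (rule homI)
    fix C D assume "C \<in> carrier (G Mod K)" "D \<in> carrier (G Mod K)"
    then obtain g h where gh: "g \<in> carrier G" "C = K #> g" "h \<in> carrier G" "D = K #> h"
      by (auto simp: carrier_FactGroup)
    then show "coset_action K C \<in> carrier (BijGroup (blocks K))"
      using coset_action_eq O.bij_prop0 by (simp add: BijGroup_def)
    show "coset_action K (C \<otimes>\<^bsub>G Mod K\<^esub> D) =
      coset_action K C \<otimes>\<^bsub>BijGroup (blocks K)\<^esub> coset_action K D"
      using gh group_hom.hom_mult[OF O.group_hom] by (simp add: K.rcos_sum coset_action_eq)
  qed
  then show ?thesis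
    using K.factorgroup_is_group group_BijGroup
    by (simp add: group_action_def group_hom_def group_hom_axioms_def)
qed

text \<open>The hypothesis puts every element acting trivially on the blocks into \<open>K\<close>,
  so only the identity coset acts trivially.\<close>

lemma coset_action_faithful:
  assumes "\<And>g. g \<in> carrier G \<Longrightarrow> (\<And>B. B \<in> blocks K \<Longrightarrow> \<phi> g ` B = B) \<Longrightarrow> g \<in> K"
  shows "faithful_action (G Mod K) (blocks K) (coset_action K)"
proof -
  interpret Q: group_action "G Mod K" "blocks K" "coset_action K"
    by (rule coset_action_group_action)
  have "C = K" if C: "C \<in> carrier (G Mod K)" "coset_action K C = \<one>\<^bsub>BijGroup (blocks K)\<^esub>" for C
  proof -
    obtain g where g: "g \<in> carrier G" "C = K #> g"
      using C by (auto simp: carrier_FactGroup)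
    then have "\<forall>B\<in>blocks K. \<phi> g ` B = B"
      using C coset_action_eq by (simp flip: orbit_action_eq_one_iff)
    then have "g \<in> K"
      by (intro assms[OF g(1)]) (rule bspec)
    then show ?thesis
      using g coset_join2[OF g(1) K.subgroup_axioms] by simp
  qed
  then have "inj_on (coset_action K) (carrier (G Mod K))"
    using group_hom.inj_on_one_iff[OF Q.group_hom] by simp
  then show ?thesis
    by (simp add: faithful_action_def faithful_action_axioms_def Q.group_action_axioms)
qed

text \<open>If \<open>g\<close> preserves the \<open>K\<close>-orbit of \<open>x\<close>, then some
  \<open>k\<close> in \<open>K\<close> has the same value as \<open>g\<close> at \<open>x\<close>.
  Thus \<open>inv k \<otimes> g\<close> fixes \<open>x\<close> and represents the same coset as
  \<open>g\<close>.\<close>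

lemma stabilizer_coset_action:
  assumes "x \<in> E"
  shows "stabilizer (G Mod K) (coset_action K) (orbit (G\<lparr>carrier := K\<rparr>) \<phi> x) =
    carrier (G\<lparr>carrier := stabilizer G \<phi> x <#> K\<rparr> Mod K)"
proof -
  let ?H = "stabilizer G \<phi> x" and ?B = "orbit (G\<lparr>carrier := K\<rparr>) \<phi> x"
  have B: "?B \<in> blocks K"
    using assms by (auto simp: orbits_def)
  have act: "coset_action K (K #> g) ?B = \<phi> g ` ?B" if "g \<in> carrier G" for g
    using coset_action_eq[OF that] B by (simp add: orbit_action_def)
  have "\<exists>h\<in>?H. K #> g = K #> h" if g: "g \<in> carrier G" "\<phi> g ` ?B = ?B" for g
  proof -
    have "\<phi> g x \<in> ?B"
      using g KA.orbit_refl[OF assms] by blast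
    then obtain k where k: "k \<in> K" "\<phi> g x = \<phi> k x"
      by (auto simp: orbit_def)
    then have "\<phi> (inv k \<otimes> g) x = x"
      using g assms by (simp add: composition_rule orbit_sym_aux)
    then have "inv k \<otimes> g \<in> ?H"
      using g k by (simp add: stabilizer_def)
    moreover have "inv k \<otimes> g \<in> K #> g"
      using k by (auto simp: r_coset_def)
    then have "K #> g = K #> (inv k \<otimes> g)"
      by (rule repr_independence[OF _ g(1) K.subgroup_axioms])
    ultimately show ?thesis
      by blast
  qed
  then have subset: "(\<lambda>g. K #> g) ` {g \<in> carrier G. \<phi> g ` ?B = ?B} \<subseteq> (\<lambda>h. K #> h) ` ?H"
    by (auto simp: image_iff)
  have "stabilizer (G Mod K) (coset_action K) ?B = (\<lambda>g. K #> g) ` {g \<in> carrier G. \<phi> g ` ?B = ?B}"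
    unfolding stabilizer_def[of "G Mod K"] carrier_FactGroup by (auto simp: act)
  also have "\<dots> = (\<lambda>h. K #> h) ` ?H"
  proof (rule subset_antisym[OF subset])
    show "(\<lambda>h. K #> h) ` ?H \<subseteq> (\<lambda>g. K #> g) ` {g \<in> carrier G. \<phi> g ` ?B = ?B}"
    proof (intro image_mono subsetI)
      fix h assume "h \<in> ?H"
      then show "h \<in> {g \<in> carrier G. \<phi> g ` ?B = ?B}"
        using assms image_orbit[of h x] by (simp add: stabilizer_def)
    qed
  qed
  also have "\<dots> = carrier (G\<lparr>carrier := ?H <#> K\<rparr> Mod K)"
    using r_cosets_set_mult[OF K stabilizer_subset] by (simp add: carrier_FactGroup)
  finally show ?thesis .
qed

text \<open>The kernel on blocks preserves one finite orbit, so it is not transitive on the infinite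
  \<open>E\<close> and must be finite. As it contains \<open>K\<close>, maximality applies.\<close>

lemma fixes_blocks_imp_mem:
  assumes "maximal_finite_normal K G" "infinite E"
    and trans: "\<And>N. N \<lhd> G \<Longrightarrow> infinite N \<Longrightarrow> acts_transitively N"
    and g: "g \<in> carrier G" "\<And>B. B \<in> blocks K \<Longrightarrow> \<phi> g ` B = B"
  shows "g \<in> K"
proof -
  have hom: "group_hom G (BijGroup (blocks K)) (orbit_action K)"
    using orbit_action_group_action by (rule group_action.group_hom)
  let ?L = "kernel G (BijGroup (blocks K)) (orbit_action K)"
  have L_iff: "g \<in> ?L \<longleftrightarrow> g \<in> carrier G \<and> (\<forall>B\<in>blocks K. \<phi> g ` B = B)" for g
    unfolding kernel_def mem_Collect_eq orbit_action_eq_one_iff by (rule refl)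
  have L: "?L \<lhd> G"
    by (rule group_hom.normal_kernel[OF hom])
  have "finite ?L"
  proof (rule ccontr)
    assume "infinite ?L"
    then have "acts_transitively ?L"
      using trans L by blast
    obtain x where x: "x \<in> E"
      using \<open>infinite E\<close> by (metis ex_in_conv finite.emptyI)
    let ?B = "orbit (G\<lparr>carrier := K\<rparr>) \<phi> x"
    have "?B \<in> blocks K" "x \<in> ?B"
      using x KA.orbit_refl by (auto simp: orbits_def)
    have "y \<in> ?B" if y: "y \<in> E" for y
    proof -
      obtain l where "l \<in> ?L" "\<phi> l x = y"
        using \<open>acts_transitively ?L\<close> x y unfolding acts_transitively_def by blast
      then show ?thesis
        using L_iff \<open>?B \<in> blocks K\<close> \<open>x \<in> ?B\<close> by blast
    qed
    then have "E \<subseteq> ?B"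
      by blast
    moreover have "finite ?B"
      using assms(1) by (simp add: orbit_def maximal_finite_normal_def setcompr_eq_image)
    ultimately show False
      using \<open>infinite E\<close> finite_subset by blast
  qed
  moreover have "K \<subseteq> ?L"
    using L_iff image_block_normal by auto
  ultimately have "?L = K"
    using assms(1) L unfolding maximal_finite_normal_def by simp
  then show ?thesis
    using L_iff g by blast
qed

end

end


section \<open>Permutation groups\<close>

locale permutation_group =
  fixes \<Omega> :: "'a set" and G :: "('a \<Rightarrow> 'a) set"
  assumes subgroup_BijGroup: "subgroup G (BijGroup \<Omega>)"

text \<open>The action is the inclusion of \<open>G\<close> into the symmetric group, an injective
  homomorphism.\<close>

sublocale permutation_group \<subseteq> faithful_action "perm_group \<Omega> G" \<Omega> "\<lambda>g. g"
proof -
  have "group_hom (perm_group \<Omega> G) (BijGroup \<Omega>) (\<lambda>g. g)"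
    using group.canonical_inj_is_hom[OF group_BijGroup subgroup_BijGroup] by (simp add: id_def)
  then show "faithful_action (perm_group \<Omega> G) \<Omega> (\<lambda>g. g)"
    by (simp add: faithful_action_def group_action_def faithful_action_axioms_def)
qed

context permutation_group
begin

lemma transitive_on_iff:
  assumes "subgroup N (perm_group \<Omega> G)"
  shows "transitive_on \<Omega> N \<longleftrightarrow> acts_transitively N"
  using induced_action[OF assms]
  by (auto simp: transitive_on_def transitive_action_def transitive_action_axioms_def
      acts_transitively_def)

lemma semiregular_on_iff:
  assumes "subgroup N (perm_group \<Omega> G)"
  shows "semiregular_on \<Omega> N \<longleftrightarrow> acts_semiregularly N"
proof -
  have "\<one>\<^bsub>BijGroup \<Omega>\<^esub> \<in> N" "\<And>x. x \<in> \<Omega> \<Longrightarrow> \<one>\<^bsub>BijGroup \<Omega>\<^esub> x = x"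
    using subgroup.one_closed[OF assms] by (simp_all add: BijGroup_def)
  then have "point_stabilizer \<Omega> N x = {\<one>\<^bsub>BijGroup \<Omega>\<^esub>} \<longleftrightarrow>
      (\<forall>g\<in>N. g x = x \<longrightarrow> g = \<one>\<^bsub>BijGroup \<Omega>\<^esub>)" if "x \<in> \<Omega>" for x
    using that unfolding point_stabilizer_def stabilizer_def by auto
  then show ?thesis
    by (simp add: semiregular_on_def acts_semiregularly_def)
qed

lemma block_action_eq_coset_action:
  "block_action (orbits (perm_group \<Omega> K) \<Omega> (\<lambda>g. g)) = coset_action K"
  by (rule ext) (simp add: block_action_def coset_action_def)

section \<open>The orbit relation of a normal subgroup as a congruence\<close>

context
  fixes K
  assumes K: "K \<lhd> perm_group \<Omega> G"
begin

interpretation KA: group_action "perm_group \<Omega> K" \<Omega> "\<lambda>g. g"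
  using induced_action[OF normal_imp_subgroup[OF K]] by simp

lemma orbit_rel_Image: "x \<in> \<Omega> \<Longrightarrow> orbit_rel \<Omega> K `` {x} = orbit (perm_group \<Omega> K) (\<lambda>g. g) x"
  by (auto simp: orbit_rel_def)

lemma quotient_orbit_rel: "\<Omega> // orbit_rel \<Omega> K = orbits (perm_group \<Omega> K) \<Omega> (\<lambda>g. g)"
  unfolding quotient_def orbits_def using orbit_rel_Image by auto

lemma orbit_subset: "x \<in> \<Omega> \<Longrightarrow> orbit (perm_group \<Omega> K) (\<lambda>g. g) x \<subseteq> \<Omega>"
  using KA.element_image by (auto simp: orbit_def)

lemma congruence_on_orbit_rel: "congruence_on \<Omega> G (orbit_rel \<Omega> K)"
  unfolding congruence_on_def
proof (intro conjI ballI)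
  show "equiv \<Omega> (orbit_rel \<Omega> K)"
  proof (rule equivI)
    show "orbit_rel \<Omega> K \<subseteq> \<Omega> \<times> \<Omega>"
      using orbit_subset by (auto simp: orbit_rel_def)
    show "refl_on \<Omega> (orbit_rel \<Omega> K)"
      using KA.orbit_refl by (auto simp: refl_on_def orbit_rel_def)
    show "sym (orbit_rel \<Omega> K)"
      using KA.orbit_sym orbit_subset unfolding sym_def orbit_rel_def by blast
    show "trans (orbit_rel \<Omega> K)"
      using KA.orbit_trans orbit_subset unfolding trans_def orbit_rel_def by blast
  qed
next
  fix g p assume g: "g \<in> G" and p: "p \<in> orbit_rel \<Omega> K"
  obtain x y where xy: "p = (x, y)" "x \<in> \<Omega>" "y \<in> orbit (perm_group \<Omega> K) (\<lambda>g. g) x"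
    using p by (auto simp: orbit_rel_def)
  then have "g y \<in> g ` orbit (perm_group \<Omega> K) (\<lambda>g. g) x"
    by blast
  also have "\<dots> = orbit (perm_group \<Omega> K) (\<lambda>g. g) (g x)"
    using image_orbit[OF K, of g x] g xy by simp
  finally show "case p of (x, y) \<Rightarrow> (g x, g y) \<in> orbit_rel \<Omega> K"
    using element_image[of g x] g xy by (simp add: orbit_rel_def)
qed

end

end

theorem theorem1p2:
  fixes \<Omega> :: "'a set" and G H :: "('a \<Rightarrow> 'a) set" and \<alpha> :: 'a
  assumes "infinite \<Omega>"
    and "subgroup G (BijGroup \<Omega>)"
    and "infinite G"
    and "\<And>N. N \<lhd> perm_group \<Omega> G \<Longrightarrow> infinite N \<Longrightarrow> transitive_on \<Omega> N"
    and "\<alpha> \<in> \<Omega>"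
    and "H = point_stabilizer \<Omega> G \<alpha>"
    and "min_N (perm_group \<Omega> H)"
  shows
    "(\<forall>K. maximal_finite_normal K (perm_group \<Omega> G) \<longrightarrow>
        semiregular_on \<Omega> K \<and>
        (let \<rho> = orbit_rel \<Omega> K;
             \<Omega>bar = \<Omega> // \<rho>;
             Gbar = perm_group \<Omega> G Mod K;
             HK = H <#>\<^bsub>BijGroup \<Omega>\<^esub> K;
             Hbar = perm_group \<Omega> HK Mod K;
             \<phi> = block_action \<Omega>bar
         in (\<lambda>h. K #>\<^bsub>BijGroup \<Omega>\<^esub> h) \<in> iso (perm_group \<Omega> H) Hbar \<and>
            congruence_on \<Omega> G \<rho> \<and>
            \<Omega>bar = orbits (perm_group \<Omega> K) \<Omega> (\<lambda>g. g) \<and>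
            faithful_action Gbar \<Omega>bar \<phi> \<and>
            (\<forall>g\<in>G. \<forall>B\<in>\<Omega>bar. \<phi> (K #>\<^bsub>BijGroup \<Omega>\<^esub> g) B = g ` B) \<and>
            normally_infinite Gbar \<and>
            stabilizer Gbar \<phi> (orbit (perm_group \<Omega> K) (\<lambda>g. g) \<alpha>) = carrier Hbar)) \<and>
     (normally_infinite (perm_group \<Omega> G) \<longleftrightarrow> quasiprimitive_on \<Omega> G) \<and>
     (normally_infinite (perm_group \<Omega> G) \<longrightarrow>
        ((\<exists>M. {N. minimal_normal N (perm_group \<Omega> G)} = {M}) \<or>
         (\<exists>M\<^sub>1 M\<^sub>2. M\<^sub>1 \<noteq> M\<^sub>2 \<and> {N. minimal_normal N (perm_group \<Omega> G)} = {M\<^sub>1, M\<^sub>2})) \<and>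
        (\<forall>M. {N. minimal_normal N (perm_group \<Omega> G)} = {M} \<longrightarrow>
           comm_group (perm_group \<Omega> M) \<and> regular_on \<Omega> M \<or>
           \<not> comm_group (perm_group \<Omega> M) \<and>
             centralizer (perm_group \<Omega> G) M = {\<one>\<^bsub>BijGroup \<Omega>\<^esub>}) \<and>
        (\<forall>M\<^sub>1 M\<^sub>2. M\<^sub>1 \<noteq> M\<^sub>2 \<and> {N. minimal_normal N (perm_group \<Omega> G)} = {M\<^sub>1, M\<^sub>2} \<longrightarrow>
           regular_on \<Omega> M\<^sub>1 \<and> regular_on \<Omega> M\<^sub>2 \<and>
           mult_map (BijGroup \<Omega>) \<in> iso (perm_group \<Omega> M\<^sub>1 \<times>\<times> perm_group \<Omega> M\<^sub>2)
             (subgroup_generated (perm_group \<Omega> G) (M\<^sub>1 \<union> M\<^sub>2)) \<and>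
           (let M\<^sub>0 = H \<inter> generate (perm_group \<Omega> G) (M\<^sub>1 \<union> M\<^sub>2)
            in minimal_normal M\<^sub>0 (perm_group \<Omega> H) \<and>
               proj_fst (BijGroup \<Omega>) M\<^sub>1 M\<^sub>2 \<in> iso (perm_group \<Omega> M\<^sub>0) (perm_group \<Omega> M\<^sub>1) \<and>
               proj_snd (BijGroup \<Omega>) M\<^sub>1 M\<^sub>2 \<in> iso (perm_group \<Omega> M\<^sub>0) (perm_group \<Omega> M\<^sub>2) \<and>
               (\<exists>\<theta> \<in> iso (perm_group \<Omega> M\<^sub>1) (perm_group \<Omega> M\<^sub>2).
                  M\<^sub>0 = {x \<otimes>\<^bsub>BijGroup \<Omega>\<^esub> \<theta> x | x. x \<in> M\<^sub>1}))))"
proof -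
  interpret permutation_group \<Omega> G
    by (rule permutation_group.intro) fact
  let ?P = "perm_group \<Omega> G"
  have H: "H = stabilizer ?P (\<lambda>g. g) \<alpha>"
    by (simp add: assms(6) point_stabilizer_def)
  have H_subgroup: "subgroup H ?P"
    unfolding H using assms(5) by (rule stabilizer_subgroup)
  have trans: "acts_transitively N" if "N \<lhd> ?P" "infinite N" for N
    using assms(4)[OF that] transitive_on_iff[OF normal_imp_subgroup[OF that(1)]] by simp
  \<comment> \<open>Forwards, a non-trivial normal subgroup is infinite, hence transitive by
    hypothesis. Backwards, a transitive subgroup moves \<open>\<alpha>\<close> to every point of the
    infinite set \<open>\<Omega>\<close>, so it is infinite.\<close>
  have quasiprimitive: "normally_infinite ?P \<longleftrightarrow> quasiprimitive_on \<Omega> G"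
  proof
    assume "normally_infinite ?P"
    then show "quasiprimitive_on \<Omega> G"
      using assms(4) by (auto simp: normally_infinite_def quasiprimitive_on_def)
  next
    assume qp: "quasiprimitive_on \<Omega> G"
    show "normally_infinite ?P"
      unfolding normally_infinite_def
    proof (intro allI impI)
      fix N assume N: "N \<lhd> ?P \<and> N \<noteq> {\<one>\<^bsub>?P\<^esub>}"
      then have "transitive_on \<Omega> N"
        using qp by (simp add: quasiprimitive_on_def)
      then have "acts_transitively N"
        using N transitive_on_iff normal_imp_subgroup by blast
      then have "\<exists>g\<in>N. y = g \<alpha>" if "y \<in> \<Omega>" for y
        using assms(5) that unfolding acts_transitively_def by metis
      then have "\<Omega> \<subseteq> (\<lambda>g. g \<alpha>) ` N"
        by (simp add: subset_iff image_iff)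
      then show "infinite N"
        using assms(1) by (meson finite_surj)
    qed
  qed

  \<comment> \<open>The quotient by the maximal finite normal subgroup\<close>
  have part1: "semiregular_on \<Omega> K \<and>
        (let \<rho> = orbit_rel \<Omega> K;
             \<Omega>bar = \<Omega> // \<rho>;
             Gbar = perm_group \<Omega> G Mod K;
             HK = H <#>\<^bsub>BijGroup \<Omega>\<^esub> K;
             Hbar = perm_group \<Omega> HK Mod K;
             \<phi> = block_action \<Omega>bar
         in (\<lambda>h. K #>\<^bsub>BijGroup \<Omega>\<^esub> h) \<in> iso (perm_group \<Omega> H) Hbar \<and>
            congruence_on \<Omega> G \<rho> \<and>
            \<Omega>bar = orbits (perm_group \<Omega> K) \<Omega> (\<lambda>g. g) \<and>
            faithful_action Gbar \<Omega>bar \<phi> \<and>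
            (\<forall>g\<in>G. \<forall>B\<in>\<Omega>bar. \<phi> (K #>\<^bsub>BijGroup \<Omega>\<^esub> g) B = g ` B) \<and>
            normally_infinite Gbar \<and>
            stabilizer Gbar \<phi> (orbit (perm_group \<Omega> K) (\<lambda>g. g) \<alpha>) = carrier Hbar)"
    if max: "maximal_finite_normal K ?P" for K
  proof -
    have K: "K \<lhd> ?P" "finite K"
      using max by (simp_all add: maximal_finite_normal_def)
    have semiregular: "acts_semiregularly K"
      using finite_normal_semiregular[OF _ trans K] assms(3) by simp
    \<comment> \<open>Semiregularity of \<open>K\<close> makes it meet the stabilizer
      \<open>H\<close> trivially, which is what the isomorphism of \<open>H\<close> with
      \<open>HK/K\<close> requires.\<close>
    have "g = \<one>\<^bsub>?P\<^esub>" if "g \<in> H" "g \<in> K" for g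
      using semiregular that assms(5) by (simp add: acts_semiregularly_def H stabilizer_def)
    moreover have "\<one>\<^bsub>?P\<^esub> \<in> H \<inter> K"
      using subgroup.one_closed H_subgroup normal_imp_subgroup[OF K(1)] by blast
    ultimately have "H \<inter> K = {\<one>\<^bsub>?P\<^esub>}"
      by blast
    note iso = r_coset_iso_Mod[OF K(1) H_subgroup this]
    have coset: "coset_action K (K #>\<^bsub>?P\<^esub> g) B = g ` B"
      if "g \<in> G" "B \<in> orbits (perm_group \<Omega> K) \<Omega> (\<lambda>g. g)" for g B
      using coset_action_eq[OF K(1)] that by (simp add: orbit_action_def)
    have faithful: "faithful_action (?P Mod K) (blocks K) (coset_action K)"
      by (rule coset_action_faithful[OF K(1)]) (rule fixes_blocks_imp_mem[OF K(1) max assms(1) trans])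
    have stab: "stabilizer (?P Mod K) (coset_action K) (orbit (perm_group \<Omega> K) (\<lambda>g. g) \<alpha>) =
        carrier (perm_group \<Omega> (H <#>\<^bsub>BijGroup \<Omega>\<^esub> K) Mod K)"
      using stabilizer_coset_action[OF K(1) assms(5)] by (simp add: H)
    show ?thesis
      unfolding Let_def quotient_orbit_rel[OF K(1)] block_action_eq_coset_action
    proof (intro conjI ballI)
      show "semiregular_on \<Omega> K"
        using semiregular semiregular_on_iff normal_imp_subgroup[OF K(1)] by blast
      show "(\<lambda>h. K #>\<^bsub>BijGroup \<Omega>\<^esub> h)
          \<in> iso (perm_group \<Omega> H) (perm_group \<Omega> (H <#>\<^bsub>BijGroup \<Omega>\<^esub> K) Mod K)"
        using iso by simp
      show "faithful_action (?P Mod K) (orbits (perm_group \<Omega> K) \<Omega> (\<lambda>g. g)) (coset_action K)"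
        using faithful by simp
      show "coset_action K (K #>\<^bsub>BijGroup \<Omega>\<^esub> g) B = g ` B"
        if "g \<in> G" "B \<in> orbits (perm_group \<Omega> K) \<Omega> (\<lambda>g. g)" for g B
        using coset[OF that] by simp
    qed (use congruence_on_orbit_rel[OF K(1)] normally_infinite_Mod[OF max] stab in simp_all)
  qed

  \<comment> \<open>Minimal normal subgroups in the normally infinite case\<close>
  have part2: "((\<exists>M. {N. minimal_normal N ?P} = {M}) \<or>
         (\<exists>M\<^sub>1 M\<^sub>2. M\<^sub>1 \<noteq> M\<^sub>2 \<and> {N. minimal_normal N ?P} = {M\<^sub>1, M\<^sub>2})) \<and>
        (\<forall>M. {N. minimal_normal N (perm_group \<Omega> G)} = {M} \<longrightarrow>
           comm_group (perm_group \<Omega> M) \<and> regular_on \<Omega> M \<or>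
           \<not> comm_group (perm_group \<Omega> M) \<and>
             centralizer (perm_group \<Omega> G) M = {\<one>\<^bsub>BijGroup \<Omega>\<^esub>}) \<and>
        (\<forall>M\<^sub>1 M\<^sub>2. M\<^sub>1 \<noteq> M\<^sub>2 \<and> {N. minimal_normal N (perm_group \<Omega> G)} = {M\<^sub>1, M\<^sub>2} \<longrightarrow>
           regular_on \<Omega> M\<^sub>1 \<and> regular_on \<Omega> M\<^sub>2 \<and>
           mult_map (BijGroup \<Omega>) \<in> iso (perm_group \<Omega> M\<^sub>1 \<times>\<times> perm_group \<Omega> M\<^sub>2)
             (subgroup_generated (perm_group \<Omega> G) (M\<^sub>1 \<union> M\<^sub>2)) \<and>
           (let M\<^sub>0 = H \<inter> generate (perm_group \<Omega> G) (M\<^sub>1 \<union> M\<^sub>2)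
            in minimal_normal M\<^sub>0 (perm_group \<Omega> H) \<and>
               proj_fst (BijGroup \<Omega>) M\<^sub>1 M\<^sub>2 \<in> iso (perm_group \<Omega> M\<^sub>0) (perm_group \<Omega> M\<^sub>1) \<and>
               proj_snd (BijGroup \<Omega>) M\<^sub>1 M\<^sub>2 \<in> iso (perm_group \<Omega> M\<^sub>0) (perm_group \<Omega> M\<^sub>2) \<and>
               (\<exists>\<theta> \<in> iso (perm_group \<Omega> M\<^sub>1) (perm_group \<Omega> M\<^sub>2).
                  M\<^sub>0 = {x \<otimes>\<^bsub>BijGroup \<Omega>\<^esub> \<theta> x | x. x \<in> M\<^sub>1})))"
    if ninf: "normally_infinite ?P"
  proof -
    interpret Q: quasiprimitive_action ?P \<Omega> "\<lambda>g. g" \<alpha>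
      by unfold_locales (use assms(5) ninf trans in \<open>auto simp: normally_infinite_def\<close>)
    have min_N: "min_N (?P\<lparr>carrier := stabilizer ?P (\<lambda>g. g) \<alpha>\<rparr>)"
      using assms(7) by (simp add: H)
    have "carrier ?P \<noteq> {\<one>\<^bsub>?P\<^esub>}"
      using assms(3) by auto
    note cases = Q.minimal_normal_cases[OF min_N this]
    have regular_iff: "regular_on \<Omega> M \<longleftrightarrow> acts_transitively M \<and> acts_semiregularly M"
      if "minimal_normal M ?P" for M
      using that transitive_on_iff semiregular_on_iff normal_imp_subgroup
      by (auto simp: regular_on_def minimal_normal_def)
    have unique: "comm_group (perm_group \<Omega> M) \<and> regular_on \<Omega> M \<or>
           \<not> comm_group (perm_group \<Omega> M) \<and> centralizer ?P M = {\<one>\<^bsub>BijGroup \<Omega>\<^esub>}"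
      if M: "{N. minimal_normal N ?P} = {M}" for M
    proof -
      have "minimal_normal M ?P"
        using M by blast
      then show ?thesis
        using Q.unique_minimal_normal[OF min_N M] regular_iff by simp
    qed
    have two: "regular_on \<Omega> M\<^sub>1 \<and> regular_on \<Omega> M\<^sub>2 \<and>
           mult_map (BijGroup \<Omega>) \<in> iso (perm_group \<Omega> M\<^sub>1 \<times>\<times> perm_group \<Omega> M\<^sub>2)
             (subgroup_generated (perm_group \<Omega> G) (M\<^sub>1 \<union> M\<^sub>2)) \<and>
           (let M\<^sub>0 = H \<inter> generate (perm_group \<Omega> G) (M\<^sub>1 \<union> M\<^sub>2)
            in minimal_normal M\<^sub>0 (perm_group \<Omega> H) \<and>
               proj_fst (BijGroup \<Omega>) M\<^sub>1 M\<^sub>2 \<in> iso (perm_group \<Omega> M\<^sub>0) (perm_group \<Omega> M\<^sub>1) \<and>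
               proj_snd (BijGroup \<Omega>) M\<^sub>1 M\<^sub>2 \<in> iso (perm_group \<Omega> M\<^sub>0) (perm_group \<Omega> M\<^sub>2) \<and>
               (\<exists>\<theta> \<in> iso (perm_group \<Omega> M\<^sub>1) (perm_group \<Omega> M\<^sub>2).
                  M\<^sub>0 = {x \<otimes>\<^bsub>BijGroup \<Omega>\<^esub> \<theta> x | x. x \<in> M\<^sub>1}))"
      if M: "M\<^sub>1 \<noteq> M\<^sub>2" "{N. minimal_normal N ?P} = {M\<^sub>1, M\<^sub>2}" for M\<^sub>1 M\<^sub>2
    proof -
      have min: "minimal_normal M\<^sub>1 ?P" "minimal_normal M\<^sub>2 ?P"
        using M by blast+
      then have sub: "subgroup M\<^sub>1 ?P" "subgroup M\<^sub>2 ?P"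
        by (simp_all add: minimal_normal_def normal_imp_subgroup)
      have "regular_on \<Omega> M\<^sub>1" "regular_on \<Omega> M\<^sub>2"
        using regular_iff min Q.minimal_normal_transitive
          Q.distinct_minimal_normal_semiregular[OF min M(1)]
          Q.distinct_minimal_normal_semiregular[OF min(2,1) M(1)[symmetric]] by simp_all
      moreover have "mult_map ?P \<in> iso (?P\<lparr>carrier := M\<^sub>1\<rparr> \<times>\<times> ?P\<lparr>carrier := M\<^sub>2\<rparr>)
          (subgroup_generated ?P (M\<^sub>1 \<union> M\<^sub>2))"
        using sub minimal_normal_Int[OF min M(1)] Q.distinct_minimal_normal_commute[OF min M(1)]
        by (rule mult_map_iso(1))
      \<comment> \<open>Multiplication in \<open>?P\<close> is that of the full symmetric group, so
        the multiplication map and the projections built from it agree.\<close>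
      moreover have mult_map: "mult_map ?P = mult_map (BijGroup \<Omega>)"
        by (simp add: mult_map_def)
      moreover have "proj_fst ?P M\<^sub>1 M\<^sub>2 = proj_fst (BijGroup \<Omega>) M\<^sub>1 M\<^sub>2"
        "proj_snd ?P M\<^sub>1 M\<^sub>2 = proj_snd (BijGroup \<Omega>) M\<^sub>1 M\<^sub>2"
        by (simp_all add: fun_eq_iff proj_fst_def proj_snd_def mult_map)
      ultimately show ?thesis
        using Q.two_minimal_normal[OF min M(1)] by (simp add: H Let_def)
    qed
    show ?thesis
      by (rule conjI[OF cases conjI])
        (rule allI, rule impI, erule unique, rule allI, rule allI, rule impI, erule conjE, erule (1) two)
  qed
  show ?thesis
    by (rule conjI[OF _ conjI])
      (rule allI, rule impI, erule part1, rule quasiprimitive, rule impI, erule part2)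
qed

end
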